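(* Let $\kappa>0$, $r=1/\kappa$, and let $x,y\in\mathbb{R}^2$ with $0<\|x-y\|<2r$. Then the set of all $\sigma\in\Sigma(x,y)$ that are in $\mathrm{cl}(\mathcal{I})$ is a homotopy class in $\Sigma(x,y)$ (a single equivalence class under $\kappa$-constrained homotopy), and every curve in this class is embedded.
   Context: Fix $\kappa>0$ and put $r=1/\kappa$. A $\kappa$-constrained plane curve is an arc-length parametrised curve $\sigma:[0,s]\to\mathbb{R}^2$ ($s>0$) which is $C^1$ and piecewise $C^2$ and satisfies $\|\sigma''(t)\|\le\kappa$ wherever $\sigma''(t)$ is defined. For $x,y\in\mathbb{R}^2$, $\Sigma(x,y)$ is the set of $\kappa$-constrained plane curves with $\sigma(0)=x$ and $\sigma(s)=y$; the length $s$ and the initial and final tangent vectors are not prescribed. $\Sigma(x,y)$ carries the $C^1$ metric: curves of different lengths are compared after rescaling their arc-length parametrisations linearly to $[0,1]$, using uniform distance of the curves and of their first derivatives. A $\kappa$-constrained homotopy between $\sigma,\gamma\in\Sigma(x,y)$ is a continuous map $H:[0,1]\to\Sigma(x,y)$ with $H(0)=\sigma$ and $H(1)=\gamma$. Two curves are $\kappa$-constrained homotopic if such an $H$ exists; the equivalence classes (path components) are called homotopy classes. For $0<\|x-y\|<2r$ let $D_1,D_2$ be the two closed disks of radius $r$ with boundary circles $C_1=\partial D_1$, $C_2=\partial D_2$ such that $C_1\cap C_2=\{x,y\}$, and set $\mathcal{I}=\mathrm{int}(D_1\cap D_2)$. A curve $\sigma$ is "in $X$" if $\sigma(t)\in X$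 for all $t$. *)

theory Defs
  imports "HOL-Analysis.Analysis"
begin

section \<open>Curves\<close>

text \<open>
  A curve is a pair of a length \<open>s\<close> and a parametrisation of \<open>{0..s}\<close>. Members of the curve
  spaces below are \<open>extensional\<close>, so that two of them are equal iff they have the same length and
  agree on \<open>{0..s}\<close>.
\<close>

type_synonym curve = "real \<times> (real \<Rightarrow> real^2)"

text \<open>\<open>C\<^sup>k\<close> on a compact interval, with one-sided derivatives at the endpoints.\<close>

primrec Ck_on :: "nat \<Rightarrow> real \<Rightarrow> real \<Rightarrow> (real \<Rightarrow> real^2) \<Rightarrow> bool" where
  "Ck_on 0 a b f \<longleftrightarrow> continuous_on {a..b} f"
| "Ck_on (Suc k) a b f \<longleftrightarrow>
     (\<exists>f'. (\<forall>t\<in>{a..b}. (f has_vector_derivative f' t) (at t within {a..b})) \<and> Ck_on k a b f')"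

text \<open>The restriction to each closed piece of some finite subdivision is \<open>C\<^sup>2\<close>.\<close>

definition piecewise_C2_on :: "real \<Rightarrow> real \<Rightarrow> (real \<Rightarrow> real^2) \<Rightarrow> bool" where
  "piecewise_C2_on a b f \<longleftrightarrow>
     (\<exists>n (p :: nat \<Rightarrow> real). p 0 = a \<and> p n = b \<and>
        (\<forall>i<n. p i < p (Suc i) \<and> Ck_on 2 (p i) (p (Suc i)) f))"

definition velocity :: "curve \<Rightarrow> real \<Rightarrow> real^2" where
  "velocity c t = vector_derivative (snd c) (at t within {0..fst c})"

text \<open>
  The last clause is the curvature bound. It is imposed exactly at those parameters where the
  second derivative exists (one-sided at \<open>0\<close> and \<open>s\<close>).
\<close>

definition constrained_curve :: "real \<Rightarrow> curve \<Rightarrow> bool" where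
  "constrained_curve \<kappa> c \<longleftrightarrow>
     (let s = fst c; \<sigma> = snd c in
        0 < s \<and> \<sigma> \<in> extensional {0..s} \<and>
        Ck_on 1 0 s \<sigma> \<and> piecewise_C2_on 0 s \<sigma> \<and>
        (\<forall>t\<in>{0..s}. norm (velocity c t) = 1) \<and>
        (\<forall>t\<in>{0..s}. \<forall>a. (velocity c has_vector_derivative a) (at t within {0..s}) \<longrightarrow> norm a \<le> \<kappa>))"

definition curve_space :: "real \<Rightarrow> real^2 \<Rightarrow> real^2 \<Rightarrow> curve set" where
  "curve_space \<kappa> x y = {c. constrained_curve \<kappa> c \<and> snd c 0 = x \<and> snd c (fst c) = y}"

definition in_region :: "curve \<Rightarrow> (real^2) set \<Rightarrow> bool" where
  "in_region c X \<longleftrightarrow> (\<forall>t\<in>{0..fst c}. snd c t \<in> X)"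

definition embedded :: "curve \<Rightarrow> bool" where
  "embedded c \<longleftrightarrow> embedding_map (top_of_set {0..fst c}) euclidean (snd c)"


section \<open>The \<open>C\<^sup>1\<close> metric, homotopies and homotopy classes\<close>

definition rescaled :: "curve \<Rightarrow> real \<Rightarrow> real^2" where
  "rescaled c t = snd c (fst c * t)"

definition rescaled_velocity :: "curve \<Rightarrow> real \<Rightarrow> real^2" where
  "rescaled_velocity c t = vector_derivative (rescaled c) (at t within {0..1})"

definition C1_dist :: "curve \<Rightarrow> curve \<Rightarrow> real" where
  "C1_dist c d =
     (SUP t\<in>{0..1}. dist (rescaled c t) (rescaled d t)) +
     (SUP t\<in>{0..1}. dist (rescaled_velocity c t) (rescaled_velocity d t))"

text \<open>
  The locale \<^locale>\<open>Metric_space\<close> asks for nonnegativity and symmetry on the whole type, hence the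
  irrelevant value \<open>0\<close> for arguments outside the space.
\<close>

definition curve_dist :: "real \<Rightarrow> real^2 \<Rightarrow> real^2 \<Rightarrow> curve \<Rightarrow> curve \<Rightarrow> real" where
  "curve_dist \<kappa> x y c d =
     (if c \<in> curve_space \<kappa> x y \<and> d \<in> curve_space \<kappa> x y then C1_dist c d else 0)"

definition curve_topology :: "real \<Rightarrow> real^2 \<Rightarrow> real^2 \<Rightarrow> curve topology" where
  "curve_topology \<kappa> x y = Metric_space.mtopology (curve_space \<kappa> x y) (curve_dist \<kappa> x y)"

definition constrained_homotopy ::
    "real \<Rightarrow> real^2 \<Rightarrow> real^2 \<Rightarrow> (real \<Rightarrow> curve) \<Rightarrow> curve \<Rightarrow> curve \<Rightarrow> bool" where
  "constrained_homotopy \<kappa> x y H \<sigma> \<gamma> \<longleftrightarrow>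
     continuous_map (top_of_set {0..1}) (curve_topology \<kappa> x y) H \<and> H 0 = \<sigma> \<and> H 1 = \<gamma>"

definition constrained_homotopic :: "real \<Rightarrow> real^2 \<Rightarrow> real^2 \<Rightarrow> curve \<Rightarrow> curve \<Rightarrow> bool" where
  "constrained_homotopic \<kappa> x y \<sigma> \<gamma> \<longleftrightarrow> (\<exists>H. constrained_homotopy \<kappa> x y H \<sigma> \<gamma>)"

definition homotopy_classes :: "real \<Rightarrow> real^2 \<Rightarrow> real^2 \<Rightarrow> curve set set" where
  "homotopy_classes \<kappa> x y =
     curve_space \<kappa> x y // {(\<sigma>, \<gamma>). constrained_homotopic \<kappa> x y \<sigma> \<gamma>}"


section \<open>Basic facts\<close>

lemma velocity_works:
  assumes "constrained_curve \<kappa> c" "t \<in> {0..fst c}"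
  shows "(snd c has_vector_derivative velocity c t) (at t within {0..fst c})"
proof -
  obtain f' where f': "\<forall>t\<in>{0..fst c}. (snd c has_vector_derivative f' t) (at t within {0..fst c})"
    using assms(1) by (auto simp: constrained_curve_def Let_def)
  have "0 < fst c" using assms(1) by (auto simp: constrained_curve_def Let_def)
  then have "velocity c t = f' t"
    unfolding velocity_def
    by (intro vector_derivative_within_closed_interval) (use f' assms(2) in auto)
  then show ?thesis using f' assms(2) by simp
qed

lemma rescaled_velocity_eq:
  assumes "constrained_curve \<kappa> c" "t \<in> {0..1}"
  shows "rescaled_velocity c t = fst c *\<^sub>R velocity c (fst c * t)"
proof -
  have s: "0 < fst c" using assms(1) by (auto simp: constrained_curve_def Let_def)
  have img: "(\<lambda>t. fst c * t) ` {0..1} \<subseteq> {0..fst c}"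
    using s by (auto simp: mult_le_cancel_left1)
  have "fst c * t \<in> {0..fst c}" using img assms(2) by blast
  then have "(snd c has_vector_derivative velocity c (fst c * t))
      (at (fst c * t) within (\<lambda>t. fst c * t) ` {0..1})"
    using velocity_works[OF assms(1)] img has_vector_derivative_within_subset by blast
  moreover have "((\<lambda>t. fst c * t) has_vector_derivative fst c) (at t within {0..1})"
    by (auto intro!: derivative_eq_intros)
  ultimately have "((snd c \<circ> (\<lambda>t. fst c * t)) has_vector_derivative fst c *\<^sub>R velocity c (fst c * t))
      (at t within {0..1})"
    by (intro vector_diff_chain_within)
  then have "(rescaled c has_vector_derivative fst c *\<^sub>R velocity c (fst c * t)) (at t within {0..1})"
    by (simp add: rescaled_def[abs_def] o_def)
  then show ?thesis
    unfolding rescaled_velocity_def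
    by (intro vector_derivative_within_closed_interval) (use assms(2) in auto)
qed

lemma norm_rescaled_velocity:
  assumes "constrained_curve \<kappa> c" "t \<in> {0..1}"
  shows "norm (rescaled_velocity c t) = fst c"
proof -
  have s: "0 < fst c" using assms(1) by (auto simp: constrained_curve_def Let_def)
  have "fst c * t \<in> {0..fst c}" using s assms(2) by (auto simp: mult_le_cancel_left1)
  then have "norm (velocity c (fst c * t)) = 1"
    using assms(1) by (auto simp: constrained_curve_def Let_def)
  then show ?thesis using rescaled_velocity_eq[OF assms] s by simp
qed

lemma bounded_rescaled:
  assumes "constrained_curve \<kappa> c"
  shows "bounded (rescaled c ` {0..1})"
proof -
  have s: "0 < fst c" using assms(1) by (auto simp: constrained_curve_def Let_def)
  have "continuous_on {0..fst c} (snd c)"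
    using velocity_works[OF assms]
    by (meson continuous_on_eq_continuous_within has_vector_derivative_continuous)
  then have "bounded (snd c ` {0..fst c})"
    using compact_continuous_image compact_imp_bounded by blast
  then show ?thesis
    by (rule bounded_subset) (use s in \<open>auto simp: rescaled_def mult_le_cancel_left1\<close>)
qed

lemma bounded_rescaled_velocity:
  assumes "constrained_curve \<kappa> c"
  shows "bounded (rescaled_velocity c ` {0..1})"
  using norm_rescaled_velocity[OF assms] by (auto simp: bounded_iff intro!: exI[of _ "fst c"])

lemma bdd_above_dist:
  fixes f g :: "real \<Rightarrow> 'a :: real_normed_vector"
  assumes "bounded (f ` S)" "bounded (g ` S)"
  shows "bdd_above ((\<lambda>t. dist (f t) (g t)) ` S)"
proof -
  obtain A B where A: "\<And>t. t \<in> S \<Longrightarrow> norm (f t) \<le> A" and B: "\<And>t. t \<in> S \<Longrightarrow> norm (g t) \<le> B"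
    using assms by (auto simp: bounded_iff)
  show ?thesis
  proof (rule bdd_aboveI2)
    fix t assume "t \<in> S"
    then show "dist (f t) (g t) \<le> A + B"
      using A B norm_triangle_ineq4[of "f t" "g t"] by (fastforce simp: dist_norm)
  qed
qed

lemma SUP_dist_nonneg:
  fixes f g :: "real \<Rightarrow> 'a :: real_normed_vector"
  assumes "bounded (f ` {0..1})" "bounded (g ` {0..1})"
  shows "0 \<le> (SUP t\<in>{0..1}. dist (f t) (g t))"
  by (rule cSUP_upper2[OF bdd_above_dist[OF assms], of 0]) auto

lemma SUP_dist_triangle:
  fixes f g h :: "real \<Rightarrow> 'a :: real_normed_vector"
  assumes "bounded (f ` {0..1})" "bounded (g ` {0..1})" "bounded (h ` {0..1})"
  shows "(SUP t\<in>{0..1}. dist (f t) (h t)) \<le>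
         (SUP t\<in>{0..1}. dist (f t) (g t)) + (SUP t\<in>{0..1}. dist (g t) (h t))"
proof (rule cSUP_least)
  fix t :: real assume t: "t \<in> {0..1}"
  have "dist (f t) (h t) \<le> dist (f t) (g t) + dist (g t) (h t)" by (rule dist_triangle)
  also have "\<dots> \<le> (SUP t\<in>{0..1}. dist (f t) (g t)) + (SUP t\<in>{0..1}. dist (g t) (h t))"
    by (intro add_mono cSUP_upper[OF t] bdd_above_dist assms)
  finally show "dist (f t) (h t) \<le> \<dots>" .
qed auto

lemma C1_dist_eq_0_imp_eq:
  assumes c: "constrained_curve \<kappa> c" and d: "constrained_curve \<kappa> d" and "C1_dist c d = 0"
  shows "c = d"
proof -
  have s: "0 < fst c" "snd c \<in> extensional {0..fst c}" "snd d \<in> extensional {0..fst d}"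
    using c d by (auto simp: constrained_curve_def Let_def)
  have "0 \<le> (SUP t\<in>{0..1}. dist (rescaled_velocity c t) (rescaled_velocity d t))"
    "0 \<le> (SUP t\<in>{0..1}. dist (rescaled c t) (rescaled d t))"
    using c d by (auto intro!: SUP_dist_nonneg bounded_rescaled bounded_rescaled_velocity)
  then have 1: "(SUP t\<in>{0..1}. dist (rescaled c t) (rescaled d t)) = 0"
    and 2: "(SUP t\<in>{0..1}. dist (rescaled_velocity c t) (rescaled_velocity d t)) = 0"
    using assms(3) by (auto simp: C1_dist_def)
  have eq: "rescaled c t = rescaled d t" if "t \<in> {0..1}" for t
    using cSUP_upper[OF that bdd_above_dist[OF bounded_rescaled[OF c] bounded_rescaled[OF d]]] 1
    by simp
  have "rescaled_velocity c 0 = rescaled_velocity d 0"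
    using cSUP_upper[OF _ bdd_above_dist[OF bounded_rescaled_velocity[OF c]
          bounded_rescaled_velocity[OF d]], of 0] 2
    by simp
  then have len: "fst c = fst d"
    using norm_rescaled_velocity[OF c, of 0] norm_rescaled_velocity[OF d, of 0] by simp
  have "snd c t = snd d t" for t
  proof (cases "t \<in> {0..fst c}")
    case True
    then have "t / fst c \<in> {0..1}" using s by auto
    from eq[OF this] show ?thesis using s len by (simp add: rescaled_def)
  next
    case False
    then show ?thesis using s len by (auto simp: extensional_def)
  qed
  then show ?thesis using len by (simp add: prod_eq_iff fun_eq_iff)
qed

lemma Metric_space_curve_space: "Metric_space (curve_space \<kappa> x y) (curve_dist \<kappa> x y)"
proof
  fix a b
  show "0 \<le> curve_dist \<kappa> x y a b"
    unfolding curve_dist_def C1_dist_def curve_space_def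
    by (auto intro!: add_nonneg_nonneg SUP_dist_nonneg bounded_rescaled bounded_rescaled_velocity)
  show "curve_dist \<kappa> x y a b = curve_dist \<kappa> x y b a"
    by (simp add: curve_dist_def C1_dist_def dist_commute)
next
  fix a b assume ab: "a \<in> curve_space \<kappa> x y" "b \<in> curve_space \<kappa> x y"
  have "C1_dist a a = 0" by (simp add: C1_dist_def)
  then show "curve_dist \<kappa> x y a b = 0 \<longleftrightarrow> a = b"
    using ab C1_dist_eq_0_imp_eq[of \<kappa> a b] by (auto simp: curve_dist_def curve_space_def)
next
  fix a b c
  assume abc: "a \<in> curve_space \<kappa> x y" "b \<in> curve_space \<kappa> x y" "c \<in> curve_space \<kappa> x y"
  then have *: "constrained_curve \<kappa> a" "constrained_curve \<kappa> b" "constrained_curve \<kappa> c"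
    by (auto simp: curve_space_def)
  show "curve_dist \<kappa> x y a c \<le> curve_dist \<kappa> x y a b + curve_dist \<kappa> x y b c"
    using SUP_dist_triangle[OF *[THEN bounded_rescaled]]
      SUP_dist_triangle[OF *[THEN bounded_rescaled_velocity]] abc
    by (simp add: curve_dist_def C1_dist_def)
qed

lemma topspace_curve_topology [simp]: "topspace (curve_topology \<kappa> x y) = curve_space \<kappa> x y"
  unfolding curve_topology_def by (rule Metric_space.topspace_mtopology[OF Metric_space_curve_space])

lemma constrained_homotopic_iff_path_component:
  "constrained_homotopic \<kappa> x y = path_component_of (curve_topology \<kappa> x y)"
  by (simp add: fun_eq_iff constrained_homotopic_def constrained_homotopy_def
      path_component_of_def pathin_def)

lemma homotopy_classes_eq_path_components:
  "homotopy_classes \<kappa> x y = path_components_of (curve_topology \<kappa> x y)"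
  by (auto simp: homotopy_classes_def quotient_def path_components_of_def
      constrained_homotopic_iff_path_component)

lemma two_circles_exist:
  fixes x y :: "real^2"
  assumes "0 < dist x y" "dist x y < 2 * r"
  shows "\<exists>c1 c2. sphere c1 r \<inter> sphere c2 r = {x, y}"
proof -
  define p q where "p = (y$1 - x$1) / 2" and "q = (y$2 - x$2) / 2"
  define m n where "m = (x$1 + y$1) / 2" and "n = (x$2 + y$2) / 2"
  have x: "x = vector [m - p, n - q]" and y: "y = vector [m + p, n + q]"
    by (auto simp: vec_eq_iff forall_2 p_def q_def m_def n_def field_simps)
  have d: "dist x y = 2 * sqrt (p\<^sup>2 + q\<^sup>2)"
  proof -
    have "dist x y = sqrt (4 * (p\<^sup>2 + q\<^sup>2))"
      by (simp add: x y dist_vec_def L2_set_def sum_2 dist_real_def power2_eq_square algebra_simps)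
    then show ?thesis by (simp only: real_sqrt_mult real_sqrt_four)
  qed
  have pos: "0 < p\<^sup>2 + q\<^sup>2" and less: "sqrt (p\<^sup>2 + q\<^sup>2) < r" using assms d by auto
  have r: "0 < r" using less pos by (meson less_trans real_sqrt_gt_zero)
  have less2: "p\<^sup>2 + q\<^sup>2 < r\<^sup>2"
    using less r by (metis real_sqrt_less_iff real_sqrt_abs abs_of_pos)
  define t where "t = sqrt (r\<^sup>2 / (p\<^sup>2 + q\<^sup>2) - 1)"
  have t: "0 < t" "(t\<^sup>2 + 1) * (p\<^sup>2 + q\<^sup>2) = r\<^sup>2"
  proof -
    have "1 < r\<^sup>2 / (p\<^sup>2 + q\<^sup>2)" using less2 pos by simp
    then have "0 < t" "t\<^sup>2 = r\<^sup>2 / (p\<^sup>2 + q\<^sup>2) - 1" by (simp_all add: t_def)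
    then show "0 < t" "(t\<^sup>2 + 1) * (p\<^sup>2 + q\<^sup>2) = r\<^sup>2" using pos by auto
  qed
  have sph: "z \<in> sphere (vector [a, b]) r \<longleftrightarrow> (z$1 - a)\<^sup>2 + (z$2 - b)\<^sup>2 = r\<^sup>2" for z :: "real^2" and a b
  proof -
    have "dist (vector [a, b]) z = sqrt ((z$1 - a)\<^sup>2 + (z$2 - b)\<^sup>2)"
      by (simp add: dist_vec_def L2_set_def sum_2 dist_real_def power2_commute)
    moreover have "sqrt A = r \<longleftrightarrow> A = r\<^sup>2" if "0 \<le> A" for A
      using r that real_sqrt_pow2[of A] by (metis abs_of_pos real_sqrt_abs)
    ultimately show ?thesis by simp
  qed
  have "z \<in> {x, y}"
    if "z \<in> sphere (vector [m - t * q, n + t * p]) r" "z \<in> sphere (vector [m + t * q, n - t * p]) r" for z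
  proof -
    define u v where "u = z$1 - m" and "v = z$2 - n"
    have e: "(u + t * q)\<^sup>2 + (v - t * p)\<^sup>2 = r\<^sup>2" "(u - t * q)\<^sup>2 + (v + t * p)\<^sup>2 = r\<^sup>2"
      using that[unfolded sph] by (simp_all add: u_def v_def algebra_simps)
    have "4 * (t * (u * q - v * p)) =
        ((u + t * q)\<^sup>2 + (v - t * p)\<^sup>2) - ((u - t * q)\<^sup>2 + (v + t * p)\<^sup>2)"
      by algebra
    then have "t * (u * q - v * p) = 0" using e by simp
    then have k: "u * q = v * p" using t by simp
    have "u\<^sup>2 + v\<^sup>2 = p\<^sup>2 + q\<^sup>2"
    proof -
      have "2 * (u\<^sup>2 + v\<^sup>2) = ((u + t * q)\<^sup>2 + (v - t * p)\<^sup>2) + ((u - t * q)\<^sup>2 + (v + t * p)\<^sup>2)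
          - 2 * ((t\<^sup>2 + 1) * (p\<^sup>2 + q\<^sup>2)) + 2 * (p\<^sup>2 + q\<^sup>2)"
        by algebra
      then show ?thesis using e t(2) by simp
    qed
    define w where "w = (u * p + v * q) / (p\<^sup>2 + q\<^sup>2)"
    have "u * (p\<^sup>2 + q\<^sup>2) = (u * p + v * q) * p" "v * (p\<^sup>2 + q\<^sup>2) = (u * p + v * q) * q"
      using k by algebra+
    then have up: "u = w * p" and vq: "v = w * q"
      using pos by (auto simp: w_def eq_divide_eq)
    have "w\<^sup>2 * (p\<^sup>2 + q\<^sup>2) = p\<^sup>2 + q\<^sup>2"
      using \<open>u\<^sup>2 + v\<^sup>2 = p\<^sup>2 + q\<^sup>2\<close> by (simp add: up vq power_mult_distrib distrib_left)
    then have "w = 1 \<or> w = -1" using pos by (auto simp: power2_eq_1_iff)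
    then show ?thesis
    proof
      assume "w = 1"
      then have "z$1 = m + p" "z$2 = n + q" using up vq by (simp_all add: u_def v_def)
      then show ?thesis by (simp add: y vec_eq_iff forall_2)
    next
      assume "w = -1"
      then have "z$1 = m - p" "z$2 = n - q" using up vq by (simp_all add: u_def v_def)
      then show ?thesis by (simp add: x vec_eq_iff forall_2)
    qed
  qed
  moreover have "{x, y} \<subseteq> sphere (vector [m - t * q, n + t * p]) r \<inter> sphere (vector [m + t * q, n - t * p]) r"
  proof -
    have "(m - p - (m - t * q))\<^sup>2 + (n - q - (n + t * p))\<^sup>2 = (t\<^sup>2 + 1) * (p\<^sup>2 + q\<^sup>2)"
      "(m - p - (m + t * q))\<^sup>2 + (n - q - (n - t * p))\<^sup>2 = (t\<^sup>2 + 1) * (p\<^sup>2 + q\<^sup>2)"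
      "(m + p - (m - t * q))\<^sup>2 + (n + q - (n + t * p))\<^sup>2 = (t\<^sup>2 + 1) * (p\<^sup>2 + q\<^sup>2)"
      "(m + p - (m + t * q))\<^sup>2 + (n + q - (n - t * p))\<^sup>2 = (t\<^sup>2 + 1) * (p\<^sup>2 + q\<^sup>2)"
      by (simp_all add: power2_eq_square algebra_simps)
    then show ?thesis
      unfolding t(2) insert_subset Int_iff sph x y vector_2 by simp
  qed
  ultimately have "sphere (vector [m - t * q, n + t * p]) r \<inter> sphere (vector [m + t * q, n - t * p]) r = {x, y}"
    by (intro equalityI subsetI) (simp_all only: Int_iff subset_eq)
  then show ?thesis by blast
qed

end

theory Submission
  imports Defs
begin

text \<open>
  A \<open>\<kappa>\<close>-constrained curve is determined by its starting point and a \<open>\<kappa>\<close>-Lipschitz angle function of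
  its unit tangent. Schur's comparison bounds the chord of a subarc of length \<open>t \<le> 2 * pi / \<kappa>\<close> from
  below by \<open>2 * sin (\<kappa> * t / 2) / \<kappa>\<close>. Hence no curve in \<open>\<Sigma>(x,y)\<close> has length \<open>pi / \<kappa>\<close>, since its chord
  would be at least \<open>2 * r\<close>, and so the curves of length less than \<open>pi / \<kappa>\<close> form a clopen set. They are
  exactly the curves in the lens: a longer curve has two points at distance at least \<open>2 * r\<close>, which
  the lens does not contain, while a short curve leaving one of the disks would lie outside a circle
  of radius \<open>r\<close> tangent to it at its farthest point from the centre. Short curves are embedded by the
  chord bound. Scaling down the angle function relative to the chord lengthens the chord of a short
  curve; cutting the curve off where the chord has its original length deforms it to the segment.
\<close>

section \<open>Piecewise \<open>C\<^sup>1\<close> functions and Lipschitz bounds\<close>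

text \<open>Mirrors \<open>piecewise_C2_on\<close> one order lower. This is the regularity that the
  tangent angle of a piecewise C2 curve has, with one-sided derivatives at the subdivision
  points.\<close>

definition piecewise_C1_on :: "real \<Rightarrow> real \<Rightarrow> (real \<Rightarrow> real) \<Rightarrow> bool" where
  "piecewise_C1_on a b f \<longleftrightarrow>
     (\<exists>n (p :: nat \<Rightarrow> real). p 0 = a \<and> p n = b \<and>
        (\<forall>i<n. p i < p (Suc i) \<and>
          (\<exists>f'. (\<forall>t\<in>{p i..p (Suc i)}. (f has_vector_derivative f' t) (at t within {p i..p (Suc i)})) \<and>
             continuous_on {p i..p (Suc i)} f')))"

section \<open>Subdivisions of an interval\<close>

lemma partition_mono:
  fixes p :: "nat \<Rightarrow> real"
  assumes "\<forall>i<n. p i < p (Suc i)" "i \<le> j" "j \<le> n"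
  shows "p i \<le> p j"
  using assms(2,3)
proof (induction rule: dec_induct)
  case (step m)
  then show ?case using assms(1)[rule_format, of m] by simp
qed simp

lemma partition_subset:
  fixes p :: "nat \<Rightarrow> real"
  assumes "\<forall>i<n. p i < p (Suc i)" "i < n"
  shows "{p i..p (Suc i)} \<subseteq> {p 0..p n}"
  using partition_mono[OF assms(1), of 0 i] partition_mono[OF assms(1), of "Suc i" n] assms(2) by auto

lemma partition_cover:
  fixes p :: "nat \<Rightarrow> real"
  assumes "t \<in> {p 0..p n} - p ` {..n}"
  shows "\<exists>i<n. p i < t \<and> t < p (Suc i)"
  using assms
proof (induction n)
  case 0
  then show ?case by auto
next
  case (Suc n)
  show ?case
  proof (cases "t \<le> p n")
    case True
    then have "t \<in> {p 0..p n} - p ` {..n}" using Suc.prems by auto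
    then show ?thesis using Suc.IH less_SucI by blast
  next
    case False
    moreover have "t \<noteq> p (Suc n)" using Suc.prems by auto
    ultimately show ?thesis using Suc.prems by (intro exI[of _ n]) auto
  qed
qed

text \<open>The homotopy cuts its curves off, so the regularity of the angle must survive on a
  shorter interval. Induction on the number of pieces drops those beyond \<open>c\<close> and
  shortens the one that contains it.\<close>

lemma piecewise_C1_on_truncate:
  assumes "piecewise_C1_on a b f" "a < c" "c \<le> b"
  shows "piecewise_C1_on a c f"
proof -
  define Q where "Q p i \<longleftrightarrow> p i < p (Suc i) \<and>
      (\<exists>f'. (\<forall>t\<in>{p i..p (Suc i)}. (f has_vector_derivative f' t) (at t within {p i..p (Suc i)})) \<and>
             continuous_on {p i..p (Suc i)} f')" for p :: "nat \<Rightarrow> real" and i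
  obtain n p where p: "p 0 = a" "p n = b" "\<forall>i<n. Q p i"
    using assms(1) unfolding piecewise_C1_on_def Q_def by blast
  have "\<exists>m q. q 0 = a \<and> q m = c \<and> (\<forall>i<m. Q q i)" if "c \<le> p n" "\<forall>i<n. Q p i" for n
    using that
  proof (induction n)
    case 0
    then show ?case using p(1) assms(2) by simp
  next
    case (Suc n)
    show ?case
    proof (cases "c \<le> p n")
      case True
      then show ?thesis using Suc by simp
    next
      case False
      \<comment> \<open>Here \<open>p n < c \<le> p (Suc n)\<close>, so only the last subdivision
        point has to move.\<close>
      define q where "q = p(Suc n := c)"
      have "Q q i" if "i < Suc n" for i
      proof (cases "i = n")
        case True
        obtain f' where f': "\<forall>t\<in>{p n..p (Suc n)}. (f has_vector_derivative f' t) (at t within {p n..p (Suc n)})"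
            "continuous_on {p n..p (Suc n)} f'"
          using Suc.prems(2) unfolding Q_def by blast
        have sub: "{p n..c} \<subseteq> {p n..p (Suc n)}" using Suc.prems(1) by auto
        have "(\<forall>t\<in>{p n..c}. (f has_vector_derivative f' t) (at t within {p n..c})) \<and> continuous_on {p n..c} f'"
          using f' sub by (meson continuous_on_subset has_vector_derivative_within_subset subsetD)
        then show ?thesis using False True unfolding Q_def q_def by auto
      next
        case False
        then have "Q p i" using Suc.prems(2) that by simp
        then show ?thesis using False that unfolding Q_def q_def by simp
      qed
      moreover have "q 0 = a" "q (Suc n) = c" using p(1) by (auto simp: q_def)
      ultimately show ?thesis by blast
    qed
  qed
  from this[of n] show ?thesis
    using p assms(3) unfolding piecewise_C1_on_def Q_def by blast
qed

lemma piecewise_C1_on_affine: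
  assumes "piecewise_C1_on a b f"
  shows "piecewise_C1_on a b (\<lambda>t. m * (f t - k))"
proof -
  have *: "\<exists>g'. (\<forall>t\<in>S. ((\<lambda>t. m * (f t - k)) has_vector_derivative g' t) (at t within S)) \<and> continuous_on S g'"
    if "\<exists>f'. (\<forall>t\<in>S. (f has_vector_derivative f' t) (at t within S)) \<and> continuous_on S f'" for S
  proof -
    from that obtain f' where f': "\<forall>t\<in>S. (f has_vector_derivative f' t) (at t within S)" "continuous_on S f'"
      by blast
    have "((\<lambda>t. m * (f t - k)) has_vector_derivative m * f' t) (at t within S)" if "t \<in> S" for t
      using f'(1) that by (auto intro!: derivative_eq_intros)
    moreover have "continuous_on S (\<lambda>t. m * f' t)" by (intro continuous_intros f')
    ultimately show ?thesis by (intro exI[of _ "\<lambda>t. m * f' t"]) auto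
  qed
  from assms obtain n p where "p 0 = a" "p n = b" "\<forall>i<n. p i < p (Suc i) \<and>
      (\<exists>f'. (\<forall>t\<in>{p i..p (Suc i)}. (f has_vector_derivative f' t) (at t within {p i..p (Suc i)})) \<and>
         continuous_on {p i..p (Suc i)} f')"
    unfolding piecewise_C1_on_def by blast
  then show ?thesis
    unfolding piecewise_C1_on_def by (intro exI[of _ n] exI[of _ p] conjI allI impI *) auto
qed

text \<open>The increment of a continuous function is the integral of its derivative even when
  finitely many points are excepted. In the application \<open>S\<close> is the set of subdivision
  points, where the angle may have a corner.\<close>

lemma lipschitz_on_derivative_bound:
  fixes f :: "real \<Rightarrow> real"
  assumes "finite S" "continuous_on {a..b} f" "0 \<le> C"
    and D: "\<And>t. t \<in> {a<..<b} - S \<Longrightarrow> \<exists>D. (f has_vector_derivative D) (at t) \<and> \<bar>D\<bar> \<le> C"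
  shows "C-lipschitz_on {a..b} f"
proof -
  obtain f' where f': "\<And>t. t \<in> {a<..<b} - S \<Longrightarrow> (f has_vector_derivative f' t) (at t) \<and> \<bar>f' t\<bar> \<le> C"
    using D by metis
  \<comment> \<open>The default value 0 keeps the bound \<open>C\<close> valid everywhere, as the
    integral estimate requires.\<close>
  define g where "g t = (if t \<in> {a<..<b} - S then f' t else 0)" for t
  have main: "\<bar>f v - f u\<bar> \<le> C * (v - u)" if "a \<le> u" "u \<le> v" "v \<le> b" for u v
  proof -
    have "(g has_integral (f v - f u)) {u..v}"
    proof (rule fundamental_theorem_of_calculus_interior_strong[OF assms(1) \<open>u \<le> v\<close>])
      fix t assume "t \<in> {u<..<v} - S"
      then have "t \<in> {a<..<b} - S" using that by auto
      then show "(f has_vector_derivative g t) (at t)" using f'[of t] by (simp add: g_def)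
    next
      show "continuous_on {u..v} f" by (rule continuous_on_subset[OF assms(2)]) (use that in auto)
    qed
    moreover have "norm (g t) \<le> C" for t using f'[of t] assms(3) by (auto simp: g_def)
    ultimately have "norm (f v - f u) \<le> C * (v - u)"
      using has_integral_bound[OF assms(3), of g "f v - f u" u v] that by auto
    then show ?thesis using that by simp
  qed
  show ?thesis
  proof (rule lipschitz_onI[OF _ assms(3)])
    fix u v assume "u \<in> {a..b}" "v \<in> {a..b}"
    then show "dist (f u) (f v) \<le> C * dist u v"
      using main[of u v] main[of v u] by (cases "u \<le> v") (auto simp: dist_real_def abs_minus_commute)
  qed
qed

text \<open>The normalised remainder of the linear approximation tends to 0, yet by the triangle
  inequality its norm is at least \<open>norm D - C\<close>. This yields the curvature clause at
  every parameter where the velocity happens to be differentiable, including subdivision points and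
  end points.\<close>

lemma norm_vector_derivative_le_lipschitz:
  fixes f :: "real \<Rightarrow> 'a :: real_normed_vector"
  assumes "C-lipschitz_on S f" "t \<in> S" "(f has_vector_derivative D) (at t within S)"
    and "at t within S \<noteq> bot"
  shows "norm D \<le> C"
proof -
  define e where "e u = (1 / norm (u - t)) *\<^sub>R (f u - (f t + (u - t) *\<^sub>R D))" for u
  have "(e \<longlongrightarrow> 0) (at t within S)"
    using assms(3) unfolding e_def[abs_def] has_vector_derivative_def has_derivative_within by simp
  then have "((\<lambda>u. norm (e u)) \<longlongrightarrow> 0) (at t within S)"
    by (rule tendsto_norm_zero)
  moreover have "\<forall>\<^sub>F u in at t within S. norm D - C \<le> norm (e u)"
    unfolding eventually_at_filter
  proof (rule always_eventually, intro allI impI)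
    fix u assume u: "u \<noteq> t" "u \<in> S"
    have "norm ((u - t) *\<^sub>R D) \<le> norm (f u - f t) + norm (f u - (f t + (u - t) *\<^sub>R D))"
      using norm_triangle_ineq4[of "f u - f t" "f u - (f t + (u - t) *\<^sub>R D)"] by simp
    moreover have "norm (f u - f t) \<le> C * \<bar>u - t\<bar>"
      using lipschitz_onD[OF assms(1), of u t] assms(2) u by (simp add: dist_norm)
    ultimately have "(norm D - C) * \<bar>u - t\<bar> \<le> norm (f u - (f t + (u - t) *\<^sub>R D))"
      using norm_scaleR[of "u - t" D] by (simp add: left_diff_distrib mult.commute[of "norm D"] del: norm_scaleR)
    then show "norm D - C \<le> norm (e u)"
      using u by (simp add: e_def pos_le_divide_eq)
  qed
  ultimately have "norm D - C \<le> 0" using assms(4) tendsto_lowerbound by blast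
  then show ?thesis by simp
qed

text \<open>Differentiability passes from the tangent to its angle through a local inverse:
  \<open>sin (\<theta> u - \<theta> t)\<close> is the imaginary part of the rotated tangent, and by
  continuity of the angle \<open>arcsin\<close> recovers \<open>\<theta> u - \<theta> t\<close> from
  it near \<open>t\<close>, with derivative 1 at 0.\<close>

lemma angle_has_vector_derivative:
  fixes \<theta> :: "real \<Rightarrow> real"
  assumes "continuous_on S \<theta>" "t \<in> S" "((\<lambda>u. cis (\<theta> u)) has_vector_derivative D) (at t within S)"
  shows "(\<theta> has_vector_derivative Im (cis (- \<theta> t) * D)) (at t within S)"
proof -
  have "((\<lambda>u. cis (- \<theta> t) * cis (\<theta> u)) has_vector_derivative cis (- \<theta> t) * D) (at t within S)"
    by (rule has_vector_derivative_mult_right[OF assms(3)])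
  then have h: "((\<lambda>u. Im (cis (- \<theta> t) * cis (\<theta> u))) has_vector_derivative Im (cis (- \<theta> t) * D)) (at t within S)"
    by (rule bounded_linear.has_vector_derivative[OF bounded_linear_Im])
  have sin_eq: "Im (cis (- \<theta> t) * cis (\<theta> u)) = sin (\<theta> u - \<theta> t)" for u
    by (simp add: cis_mult)
  have h: "((\<lambda>u. sin (\<theta> u - \<theta> t)) has_vector_derivative Im (cis (- \<theta> t) * D)) (at t within S)"
    using h by (simp only: sin_eq)
  have a: "(arcsin has_field_derivative 1) (at (sin (\<theta> t - \<theta> t)) within (\<lambda>u. sin (\<theta> u - \<theta> t)) ` S)"
    using DERIV_arcsin[of 0] by (auto intro: has_field_derivative_at_within)
  have "((\<lambda>u. arcsin (sin (\<theta> u - \<theta> t))) has_vector_derivative Im (cis (- \<theta> t) * D)) (at t within S)"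
    using field_vector_diff_chain_within[OF h a] by (simp add: o_def)
  then have "((\<lambda>u. arcsin (sin (\<theta> u - \<theta> t)) + \<theta> t) has_vector_derivative Im (cis (- \<theta> t) * D)) (at t within S)"
    by (auto intro!: derivative_eq_intros)
  moreover have "\<forall>\<^sub>F u in at t within S. arcsin (sin (\<theta> u - \<theta> t)) + \<theta> t = \<theta> u"
  proof -
    have "(\<theta> \<longlongrightarrow> \<theta> t) (at t within S)" using assms(1,2) by (simp add: continuous_on_def)
    then have "\<forall>\<^sub>F u in at t within S. dist (\<theta> u) (\<theta> t) < pi / 2"
      by (rule tendstoD) simp
    then show ?thesis
    proof (rule eventually_mono)
      fix u assume "dist (\<theta> u) (\<theta> t) < pi / 2"
      then show "arcsin (sin (\<theta> u - \<theta> t)) + \<theta> t = \<theta> u"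
        by (subst arcsin_sin) (auto simp: dist_real_def abs_if field_simps split: if_splits)
    qed
  qed
  ultimately show ?thesis
    unfolding has_vector_derivative_def
    by (rule has_derivative_transform_eventually) (use assms(2) in simp_all)
qed


section \<open>Curves with an angle function of bounded speed\<close>

text \<open>The unit-speed curve in the complex plane that starts at 0 and whose tangent at
  parameter \<open>v\<close> has angle \<open>\<theta> v\<close>.\<close>

definition develop :: "(real \<Rightarrow> real) \<Rightarrow> real \<Rightarrow> complex" where
  "develop \<theta> t = integral {0..t} (\<lambda>v. cis (\<theta> v))"

text \<open>The chord of the unit circle is \<open>2 * \<bar>sin ((a - b) / 2)\<bar>\<close>, which
  the arc length bounds.\<close>

lemma dist_cis_le: "dist (cis a) (cis b) \<le> \<bar>a - b\<bar>"
proof (rule power2_le_imp_le)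
  have "(dist (cis a) (cis b))\<^sup>2 = 2 - 2 * cos (a - b)"
    unfolding dist_norm cmod_power2 using sin_cos_squared_add[of a] sin_cos_squared_add[of b]
    by (simp add: power2_diff cos_diff algebra_simps)
  also have "cos (a - b) = 1 - 2 * (sin ((a - b) / 2))\<^sup>2"
    using cos_double_sin[of "(a - b) / 2"] by (simp only: mult_2 field_sum_of_halves)
  also have "2 - 2 * (1 - 2 * (sin ((a - b) / 2))\<^sup>2) = (2 * \<bar>sin ((a - b) / 2)\<bar>)\<^sup>2"
    by (simp add: power_mult_distrib)
  also have "\<dots> \<le> \<bar>a - b\<bar>\<^sup>2"
    using abs_sin_x_le_abs_x[of "(a - b) / 2"] by (intro power_mono) auto
  finally show "(dist (cis a) (cis b))\<^sup>2 \<le> \<bar>a - b\<bar>\<^sup>2" .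
qed simp

context
  fixes \<kappa> s :: real and \<theta> :: "real \<Rightarrow> real"
  assumes kappa: "0 < \<kappa>" and lip: "\<kappa>-lipschitz_on {0..s} \<theta>"
begin

lemma continuous_angle: "continuous_on {0..s} \<theta>"
  using lip by (rule lipschitz_on_continuous_on)

lemma continuous_cis_angle: "continuous_on {0..s} (\<lambda>t. cis (\<theta> t))"
  by (intro continuous_intros continuous_angle)

lemma cis_angle_integrable: "0 \<le> a \<Longrightarrow> b \<le> s \<Longrightarrow> (\<lambda>t. cis (\<theta> t)) integrable_on {a..b}"
  by (rule integrable_continuous_real, rule continuous_on_subset[OF continuous_cis_angle]) auto

lemma develop_has_vector_derivative:
  "t \<in> {0..s} \<Longrightarrow> (develop \<theta> has_vector_derivative cis (\<theta> t)) (at t within {0..s})"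
  unfolding develop_def[abs_def] by (rule integral_has_vector_derivative[OF continuous_cis_angle])

lemma develop_diff:
  assumes "0 \<le> a" "a \<le> b" "b \<le> s"
  shows "develop \<theta> b - develop \<theta> a = integral {a..b} (\<lambda>t. cis (\<theta> t))"
  using Henstock_Kurzweil_Integration.integral_combine[OF assms(1,2) cis_angle_integrable[of 0 b]] assms
  by (simp add: develop_def algebra_simps)

lemma continuous_develop: "continuous_on {0..s} (develop \<theta>)"
  using develop_has_vector_derivative
  by (meson continuous_on_eq_continuous_within has_vector_derivative_continuous)

lemma norm_develop_diff_le:
  assumes "0 \<le> a" "a \<le> b" "b \<le> s"
  shows "norm (develop \<theta> b - develop \<theta> a) \<le> b - a"
proof -
  have "norm (integral {a..b} (\<lambda>t. cis (\<theta> t))) \<le> 1 * (b - a)"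
    by (rule integral_bound) (use assms continuous_on_subset[OF continuous_cis_angle] in auto)
  then show ?thesis using develop_diff[OF assms] by simp
qed

section \<open>Comparison with circular arcs\<close>

text \<open>A. Schur's comparison: among angle functions with Lipschitz constant \<open>\<kappa>\<close>, the circular
  arc makes the least progress along the tangent at the parameter \<open>m\<close>.\<close>

lemma Schur_comparison:
  assumes "0 \<le> a" "a \<le> m" "m \<le> b" "b \<le> s" and "\<kappa> * (b - m) \<le> pi" "\<kappa> * (m - a) \<le> pi"
  shows "(sin (\<kappa> * (b - m)) + sin (\<kappa> * (m - a))) / \<kappa>
    \<le> Re (cis (- \<theta> m) * (develop \<theta> b - develop \<theta> a))"
proof -
  have "((\<lambda>t. cos (\<kappa> * (t - m))) has_integral (sin (\<kappa> * (b - m)) / \<kappa> - sin (\<kappa> * (a - m)) / \<kappa>)) {a..b}"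
    by (rule fundamental_theorem_of_calculus)
      (use assms kappa in \<open>auto intro!: derivative_eq_intros simp: has_real_derivative_iff_has_vector_derivative[symmetric]\<close>)
  moreover have "((\<lambda>t. Re (cis (- \<theta> m) * cis (\<theta> t))) has_integral
      Re (cis (- \<theta> m) * (develop \<theta> b - develop \<theta> a))) {a..b}"
  proof -
    have "((\<lambda>t. cis (\<theta> t)) has_integral (develop \<theta> b - develop \<theta> a)) {a..b}"
      using develop_diff cis_angle_integrable assms by (simp add: has_integral_integral)
    from has_integral_linear[OF has_integral_mult_right[OF this, of "cis (- \<theta> m)"] bounded_linear_Re]
    show ?thesis by (simp add: o_def)
  qed
  \<comment> \<open>Pointwise comparison of the integrands: the tangent turns by at most
    \<open>\<kappa> * \<bar>t - m\<bar> \<le> pi\<close> away from its direction at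
    \<open>m\<close>, and the cosine decreases on this range.\<close>
  moreover have "cos (\<kappa> * (t - m)) \<le> Re (cis (- \<theta> m) * cis (\<theta> t))" if "t \<in> {a..b}" for t
  proof -
    have "\<bar>\<theta> t - \<theta> m\<bar> \<le> \<kappa> * \<bar>t - m\<bar>"
      using lipschitz_onD[OF lip, of t m] assms that by (auto simp: dist_real_def)
    moreover have "\<kappa> * \<bar>t - m\<bar> \<le> pi"
    proof (cases "t \<le> m")
      case True
      then have "\<kappa> * \<bar>t - m\<bar> \<le> \<kappa> * (m - a)" using that kappa by (intro mult_left_mono) auto
      then show ?thesis using assms by simp
    next
      case False
      then have "\<kappa> * \<bar>t - m\<bar> \<le> \<kappa> * (b - m)" using that kappa by (intro mult_left_mono) auto
      then show ?thesis using assms by simp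
    qed
    ultimately have "cos (\<kappa> * \<bar>t - m\<bar>) \<le> cos \<bar>\<theta> t - \<theta> m\<bar>"
      by (intro cos_monotone_0_pi_le) auto
    moreover have "cos (\<kappa> * \<bar>t - m\<bar>) = cos (\<kappa> * (t - m))"
      using kappa cos_abs_real[of "\<kappa> * (t - m)"] by (simp add: abs_mult)
    ultimately show ?thesis by (simp add: cis_mult)
  qed
  ultimately have "sin (\<kappa> * (b - m)) / \<kappa> - sin (\<kappa> * (a - m)) / \<kappa>
      \<le> Re (cis (- \<theta> m) * (develop \<theta> b - develop \<theta> a))"
    by (rule has_integral_le)
  moreover have "sin (\<kappa> * (a - m)) = - sin (\<kappa> * (m - a))"
    using sin_minus[of "\<kappa> * (m - a)"] by (simp add: algebra_simps)
  ultimately show ?thesis by (simp add: add_divide_distrib)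
qed

text \<open>The counterpart of Schur's comparison in the normal direction. Within a quarter turn the
  sine increases, so the normal speed is at most that of the circular arc; the bound is how far an
  arc of radius \<open>1 / \<kappa>\<close> departs from its tangent at one end.\<close>

lemma normal_deviation_le:
  assumes "0 \<le> a" "a \<le> b" "b \<le> s" "m = a \<or> m = b" "\<kappa> * (b - a) \<le> pi / 2"
  shows "\<bar>Im (cis (- \<theta> m) * (develop \<theta> b - develop \<theta> a))\<bar> \<le> (1 - cos (\<kappa> * (b - a))) / \<kappa>"
proof -
  have int: "((\<lambda>t. Im (cis (- \<theta> m) * cis (\<theta> t))) has_integral
      Im (cis (- \<theta> m) * (develop \<theta> b - develop \<theta> a))) {a..b}"
  proof -
    have "((\<lambda>t. cis (\<theta> t)) has_integral (develop \<theta> b - develop \<theta> a)) {a..b}"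
      using develop_diff cis_angle_integrable assms by (simp add: has_integral_integral)
    from has_integral_linear[OF has_integral_mult_right[OF this, of "cis (- \<theta> m)"] bounded_linear_Im]
    show ?thesis by (simp add: o_def)
  qed
  have bound: "norm (Im (cis (- \<theta> m) * cis (\<theta> t))) \<le> sin (\<kappa> * \<bar>t - m\<bar>)" if "t \<in> {a..b}" for t
  proof -
    have "\<bar>\<theta> t - \<theta> m\<bar> \<le> \<kappa> * \<bar>t - m\<bar>"
      using lipschitz_onD[OF lip, of t m] assms that by (auto simp: dist_real_def)
    moreover have "\<kappa> * \<bar>t - m\<bar> \<le> \<kappa> * (b - a)" using that kappa assms(4) by (intro mult_left_mono) auto
    ultimately have *: "sin \<bar>\<theta> t - \<theta> m\<bar> \<le> sin (\<kappa> * \<bar>t - m\<bar>)" "\<bar>\<theta> t - \<theta> m\<bar> \<le> pi"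
      using assms(5) pi_gt_zero by (intro sin_monotone_2pi_le, linarith+)
    have "\<bar>sin d\<bar> = sin \<bar>d\<bar>" if "\<bar>d\<bar> \<le> pi" for d :: real
      using that sin_ge_zero[of "\<bar>d\<bar>"] by (cases "0 \<le> d") auto
    from this[OF *(2)] show ?thesis using * by (simp add: cis_mult)
  qed
  have int': "((\<lambda>t. sin (\<kappa> * \<bar>t - m\<bar>)) has_integral (1 - cos (\<kappa> * (b - a))) / \<kappa>) {a..b}"
    using assms(4)
  proof
    assume m: "m = a"
    have "((\<lambda>t. sin (\<kappa> * (t - a))) has_integral (- cos (\<kappa> * (b - a)) / \<kappa> - (- cos (\<kappa> * (a - a)) / \<kappa>))) {a..b}"
      by (rule fundamental_theorem_of_calculus)
        (use assms kappa in \<open>auto intro!: derivative_eq_intros simp: has_real_derivative_iff_has_vector_derivative[symmetric]\<close>)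
    then have "((\<lambda>t. sin (\<kappa> * (t - a))) has_integral (1 - cos (\<kappa> * (b - a))) / \<kappa>) {a..b}"
      by (simp add: diff_divide_distrib)
    then show ?thesis by (rule has_integral_eq[rotated]) (simp add: m)
  next
    assume m: "m = b"
    have "((\<lambda>t. sin (\<kappa> * (b - t))) has_integral (cos (\<kappa> * (b - b)) / \<kappa> - (cos (\<kappa> * (b - a)) / \<kappa>))) {a..b}"
      by (rule fundamental_theorem_of_calculus)
        (use assms kappa in \<open>auto intro!: derivative_eq_intros simp: has_real_derivative_iff_has_vector_derivative[symmetric]\<close>)
    then have "((\<lambda>t. sin (\<kappa> * (b - t))) has_integral (1 - cos (\<kappa> * (b - a))) / \<kappa>) {a..b}"
      by (simp add: diff_divide_distrib)
    then show ?thesis by (rule has_integral_eq[rotated]) (simp add: m)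
  qed
  from integral_norm_bound_integral[OF has_integral_integrable[OF int] has_integral_integrable[OF int'] bound]
  show ?thesis using integral_unique[OF int] integral_unique[OF int'] by simp
qed

text \<open>Schur's comparison is applied at the midpoint, where each half turns by at most pi. The
  projection of the chord onto the tangent there bounds its length from below.\<close>

lemma develop_chord_ge:
  assumes "0 \<le> a" "a \<le> b" "b \<le> s" "\<kappa> * (b - a) \<le> 2 * pi"
  shows "2 * sin (\<kappa> * (b - a) / 2) / \<kappa> \<le> norm (develop \<theta> b - develop \<theta> a)"
proof -
  define m where "m = (a + b) / 2"
  have "\<kappa> * (b - m) = \<kappa> * (b - a) / 2" "\<kappa> * (m - a) = \<kappa> * (b - a) / 2" "a \<le> m" "m \<le> b"
    using assms by (auto simp: m_def field_simps)
  then have "2 * sin (\<kappa> * (b - a) / 2) / \<kappa> \<le> Re (cis (- \<theta> m) * (develop \<theta> b - develop \<theta> a))"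
    using Schur_comparison[of a m b] assms by (simp only: mult_2[symmetric])
  also have "\<dots> \<le> norm (cis (- \<theta> m) * (develop \<theta> b - develop \<theta> a))" by (rule complex_Re_le_cmod)
  finally show ?thesis by (simp add: norm_mult)
qed

lemma inj_on_develop:
  assumes "\<kappa> * s \<le> pi"
  shows "inj_on (develop \<theta>) {0..s}"
proof -
  have "develop \<theta> a \<noteq> develop \<theta> b" if "0 \<le> a" "a < b" "b \<le> s" for a b
  proof -
    have le: "\<kappa> * (b - a) \<le> \<kappa> * s" using that kappa by (intro mult_left_mono) auto
    then have "0 < sin (\<kappa> * (b - a) / 2)"
      using that kappa assms le pi_gt_zero by (intro sin_gt_zero) (simp, linarith)
    then have "0 < 2 * sin (\<kappa> * (b - a) / 2) / \<kappa>" using kappa by simp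
    also have "\<dots> \<le> norm (develop \<theta> b - develop \<theta> a)"
      using le assms that pi_gt_zero by (intro develop_chord_ge) linarith+
    finally show ?thesis by auto
  qed
  then show ?thesis by (intro linorder_inj_onI') auto
qed

text \<open>The derivative of the squared distance from the start is twice the inner product of
  tangent and position, which Schur's comparison at the end of the arc makes positive. Strictness is
  what makes the cut-off parameter of the homotopy unique.\<close>

lemma norm_develop_strict_mono:
  assumes "\<kappa> * s < pi" "0 \<le> a" "a < b" "b \<le> s"
  shows "norm (develop \<theta> a) < norm (develop \<theta> b)"
proof -
  define g where "g t = (Re (develop \<theta> t))\<^sup>2 + (Im (develop \<theta> t))\<^sup>2" for t
  have "g a < g b"
  proof (rule DERIV_pos_imp_increasing_open[OF \<open>a < b\<close>])
    fix t assume t: "a < t" "t < b"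
    then have ts: "t \<in> {0<..<s}" using assms by auto
    then have "(develop \<theta> has_vector_derivative cis (\<theta> t)) (at t)"
      using develop_has_vector_derivative[of t] at_within_Icc_at[of 0 t s] by auto
    then have "((\<lambda>t. Re (develop \<theta> t)) has_real_derivative cos (\<theta> t)) (at t)"
      "((\<lambda>t. Im (develop \<theta> t)) has_real_derivative sin (\<theta> t)) (at t)"
      using bounded_linear.has_vector_derivative[OF bounded_linear_Re] bounded_linear.has_vector_derivative[OF bounded_linear_Im]
      by (fastforce simp: has_real_derivative_iff_has_vector_derivative)+
    then have "(g has_real_derivative 2 * (cos (\<theta> t) * Re (develop \<theta> t) + sin (\<theta> t) * Im (develop \<theta> t))) (at t)"
      unfolding g_def
      by (rule DERIV_cong[OF DERIV_add[OF DERIV_power[of _ _ _ _ 2] DERIV_power[of _ _ _ _ 2]]]) simp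
    moreover have "0 < cos (\<theta> t) * Re (develop \<theta> t) + sin (\<theta> t) * Im (develop \<theta> t)"
    proof -
      have "\<kappa> * t < \<kappa> * s" using ts kappa by simp
      then have "\<kappa> * t < pi" using assms(1) by linarith
      moreover have "0 < \<kappa> * t" using ts kappa by simp
      ultimately have "0 < sin (\<kappa> * t)" "\<kappa> * t \<le> pi" by (auto intro: sin_gt_zero)
      then have "0 < (sin (\<kappa> * (t - t)) + sin (\<kappa> * (t - 0))) / \<kappa>" using kappa by simp
      also have "\<dots> \<le> Re (cis (- \<theta> t) * (develop \<theta> t - develop \<theta> 0))"
        by (rule Schur_comparison) (use ts \<open>\<kappa> * t \<le> pi\<close> in auto)
      finally show ?thesis by (simp add: develop_def)
    qed
    ultimately show "\<exists>y. (g has_real_derivative y) (at t) \<and> 0 < y" by (meson mult_pos_pos zero_less_numeral)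
  next
    have "continuous_on {a..b} (develop \<theta>)"
      by (rule continuous_on_subset[OF continuous_develop]) (use assms in auto)
    then show "continuous_on {a..b} g" unfolding g_def[abs_def] by (intro continuous_intros)
  qed
  then show ?thesis by (simp add: g_def cmod_def)
qed

text \<open>At a point of maximal distance from the centre the curve is tangent to a circle of radius
  \<open>1/\<kappa>\<close> around which it has to stay outside for a quarter turn in each direction, and one of its end
  points is reached within such a quarter turn.\<close>

lemma develop_in_disc:
  assumes "\<kappa> * s \<le> pi" and w: "norm w = 1"
    and "norm q \<le> 1 / \<kappa>" "norm (q + w * develop \<theta> s) \<le> 1 / \<kappa>" and "t \<in> {0..s}"
  shows "norm (q + w * develop \<theta> t) \<le> 1 / \<kappa>"
proof (rule ccontr)
  assume far: "\<not> norm (q + w * develop \<theta> t) \<le> 1 / \<kappa>"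
  define Q where "Q u = q + w * develop \<theta> u" for u
  have "continuous_on {0..s} (\<lambda>u. norm (Q u))"
    unfolding Q_def by (intro continuous_intros continuous_develop)
  then obtain m where m: "m \<in> {0..s}" "\<And>u. u \<in> {0..s} \<Longrightarrow> norm (Q u) \<le> norm (Q m)"
    using continuous_attains_sup[of "{0..s}" "\<lambda>u. norm (Q u)"] assms(5) by auto
  define R where "R = norm (Q m)"
  have R: "1 / \<kappa> < R" using far m(2)[OF assms(5)] by (simp add: R_def Q_def)
  have Q0: "norm (Q 0) \<le> 1 / \<kappa>" "norm (Q s) \<le> 1 / \<kappa>" using assms(3,4) by (simp_all add: Q_def develop_def)
  then have ms: "0 < m" "m < s"
    using m(1) R unfolding R_def by (metis atLeastAtMost_iff leD order_le_less)+
  \<comment> \<open>\<open>e\<close> is the tangent at the farthest point. Multiplication by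
    \<open>cnj e\<close> passes to a frame whose real axis is this tangent and whose imaginary axis
    is the normal; in it \<open>Q m\<close> is purely imaginary.\<close>
  define e where "e = w * cis (\<theta> m)"
  have e: "norm e = 1" by (simp add: e_def norm_mult w)
  have Re0: "Re (cnj e * Q m) = 0"
  proof -
    have "(Q has_vector_derivative e) (at m)"
      using develop_has_vector_derivative[OF m(1)] at_within_Icc_at[OF ms]
      unfolding Q_def[abs_def] e_def by (auto intro!: derivative_eq_intros)
    then have d: "((\<lambda>t. Re (Q t)) has_real_derivative Re e) (at m)"
      "((\<lambda>t. Im (Q t)) has_real_derivative Im e) (at m)"
      using bounded_linear.has_vector_derivative[OF bounded_linear_Re] bounded_linear.has_vector_derivative[OF bounded_linear_Im]
      by (fastforce simp: has_real_derivative_iff_has_vector_derivative)+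
    have "((\<lambda>t. (Re (Q t))\<^sup>2 + (Im (Q t))\<^sup>2) has_real_derivative 2 * (Re e * Re (Q m) + Im e * Im (Q m))) (at m)"
      by (rule DERIV_cong[OF DERIV_add[OF DERIV_power[OF d(1), of 2] DERIV_power[OF d(2), of 2]]]) simp
    moreover have "(Re (Q u))\<^sup>2 + (Im (Q u))\<^sup>2 \<le> (Re (Q m))\<^sup>2 + (Im (Q m))\<^sup>2" if "\<bar>m - u\<bar> < min m (s - m)" for u
      using m(2)[of u] that by (auto simp: cmod_def abs_if split: if_splits)
    ultimately have "2 * (Re e * Re (Q m) + Im e * Im (Q m)) = 0"
      using ms by (intro DERIV_local_max[of _ _ m "min m (s - m)"]) auto
    then show ?thesis by simp
  qed
  have cnj_e: "cnj e * w = cis (- \<theta> m)"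
  proof -
    have "cnj w * w = 1" using w complex_norm_square[of w] by (simp add: mult.commute)
    then show ?thesis by (simp add: e_def cis_cnj mult_ac)
  qed
  have norm_cnj: "norm (cnj e * z) = norm z" for z by (simp add: norm_mult e)
  define h where "h = Im (cnj e * Q m)"
  have h: "\<bar>h\<bar> = R"
    using norm_cnj[of "Q m"] Re0 by (simp only: h_def R_def cmod_def) simp
  \<comment> \<open>A point reached from \<open>Q m\<close> after a length
    \<open>b / \<kappa>\<close> within a quarter turn has tangential part at least
    \<open>sin b / \<kappa>\<close>. Its normal part exceeds \<open>cos b / \<kappa>\<close>, since
    \<open>Q m\<close> lies at height \<open>R > 1 / \<kappa>\<close> and the deviation is at most
    \<open>(1 - cos b) / \<kappa>\<close>. Pythagoras puts it outside the disk.\<close>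
  have key: "1 / \<kappa> < norm z"
    if b: "0 \<le> b" "b \<le> pi / 2" and re: "sin b / \<kappa> \<le> \<bar>Re (cnj e * z)\<bar>"
      and im: "\<bar>Im (cnj e * z) - h\<bar> \<le> (1 - cos b) / \<kappa>" for b z
  proof -
    have sc: "0 \<le> sin b" "0 \<le> cos b" using b by (auto intro: sin_ge_zero cos_ge_zero)
    have "cos b / \<kappa> < \<bar>Im (cnj e * z)\<bar>"
      using im h R kappa by (simp add: diff_divide_distrib abs_if split: if_splits)
    then have "(cos b / \<kappa>)\<^sup>2 < (Im (cnj e * z))\<^sup>2"
      using sc kappa by (metis divide_nonneg_pos power2_abs power_strict_mono zero_less_numeral)
    moreover have "(sin b / \<kappa>)\<^sup>2 \<le> (Re (cnj e * z))\<^sup>2"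
      using re sc kappa by (metis divide_nonneg_pos power2_abs power_mono)
    moreover have "(sin b / \<kappa>)\<^sup>2 + (cos b / \<kappa>)\<^sup>2 = (1 / \<kappa>)\<^sup>2"
      by (simp add: power_divide add_divide_distrib[symmetric])
    ultimately have "(1 / \<kappa>)\<^sup>2 < (norm (cnj e * z))\<^sup>2" by (simp only: cmod_power2)
    then show ?thesis using norm_cnj power2_less_imp_less norm_ge_zero by metis
  qed
  have diff: "cnj e * (Q v - Q u) = cis (- \<theta> m) * (develop \<theta> v - develop \<theta> u)" for u v
    unfolding Q_def using cnj_e by (simp add: algebra_simps flip: mult.assoc)
  have "\<kappa> * m + \<kappa> * (s - m) \<le> pi" using assms(1) by (simp add: algebra_simps)
  then consider "\<kappa> * m \<le> pi / 2" | "\<kappa> * (s - m) \<le> pi / 2" by linarith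
  then show False
  proof cases
    case 1
    have "sin (\<kappa> * m) / \<kappa> \<le> Re (cnj e * (Q m - Q 0))"
      using Schur_comparison[of 0 m m] 1 ms pi_gt_zero unfolding diff by (simp del: pi_gt_zero)
    moreover have "\<bar>Im (cnj e * (Q m - Q 0))\<bar> \<le> (1 - cos (\<kappa> * m)) / \<kappa>"
      using normal_deviation_le[of 0 m m] 1 ms unfolding diff by simp
    ultimately have "1 / \<kappa> < norm (Q 0)"
      using Re0 1 ms kappa
      by (intro key[of "\<kappa> * m"]) (simp_all add: h_def right_diff_distrib abs_minus_commute del: times_complex.sel complex_cnj)
    then show False using Q0 by simp
  next
    case 2
    have "sin (\<kappa> * (s - m)) / \<kappa> \<le> Re (cnj e * (Q s - Q m))"
      using Schur_comparison[of m m s] 2 ms pi_gt_zero unfolding diff by (simp del: pi_gt_zero)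
    moreover have "\<bar>Im (cnj e * (Q s - Q m))\<bar> \<le> (1 - cos (\<kappa> * (s - m))) / \<kappa>"
      using normal_deviation_le[of m s m] 2 ms unfolding diff by simp
    ultimately have "1 / \<kappa> < norm (Q s)"
      using Re0 2 ms kappa
      by (intro key[of "\<kappa> * (s - m)"]) (simp_all add: h_def right_diff_distrib del: times_complex.sel complex_cnj)
    then show False using Q0 by simp
  qed
qed

end


section \<open>Constrained curves and angle functions\<close>

definition cvec :: "complex \<Rightarrow> real^2" where
  "cvec z = vector [Re z, Im z]"

definition vcomplex :: "real^2 \<Rightarrow> complex" where
  "vcomplex v = Complex (v$1) (v$2)"

lemma cvec_vcomplex [simp]: "cvec (vcomplex v) = v"
  by (simp add: cvec_def vcomplex_def vec_eq_iff forall_2)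

lemma vcomplex_cvec [simp]: "vcomplex (cvec z) = z"
  by (simp add: cvec_def vcomplex_def)

lemma norm_cvec [simp]: "norm (cvec z) = norm z"
  by (simp add: norm_vec_def L2_set_def sum_2 cvec_def cmod_def)

lemma norm_vcomplex [simp]: "norm (vcomplex v) = norm v"
  using norm_cvec[of "vcomplex v"] by simp

lemma bounded_linear_cvec: "bounded_linear cvec"
  by (rule linear_conv_bounded_linear[THEN iffD1], rule linearI)
    (simp_all add: cvec_def vec_eq_iff forall_2)

lemma bounded_linear_vcomplex: "bounded_linear vcomplex"
  by (rule linear_conv_bounded_linear[THEN iffD1], rule linearI)
    (simp_all add: vcomplex_def complex_eq_iff)

lemmas cvec_diff = linear_diff[OF bounded_linear.linear[OF bounded_linear_cvec]]
  and vcomplex_diff = linear_diff[OF bounded_linear.linear[OF bounded_linear_vcomplex]]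
  and vcomplex_add = linear_add[OF bounded_linear.linear[OF bounded_linear_vcomplex]]

text \<open>The rotation \<open>w\<close> is kept apart from the angle so that the homotopy can
  bring end points back to \<open>y\<close>. The restriction gives the \<open>extensional\<close>
  representative that the curve space demands.\<close>

definition angle_curve :: "real^2 \<Rightarrow> complex \<Rightarrow> (real \<Rightarrow> real) \<Rightarrow> real \<Rightarrow> curve" where
  "angle_curve x w \<theta> s = (s, restrict (\<lambda>t. x + cvec (w * develop \<theta> t)) {0..s})"

lemma fst_angle_curve [simp]: "fst (angle_curve x w \<theta> s) = s"
  by (simp add: angle_curve_def)

lemma snd_angle_curve: "t \<in> {0..s} \<Longrightarrow> snd (angle_curve x w \<theta> s) t = x + cvec (w * develop \<theta> t)"
  by (simp add: angle_curve_def)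

lemma angle_curve_has_vector_derivative:
  assumes "0 < \<kappa>" "\<kappa>-lipschitz_on {0..s} \<theta>" "t \<in> {0..s}"
  shows "(snd (angle_curve x w \<theta> s) has_vector_derivative cvec (w * cis (\<theta> t))) (at t within {0..s})"
proof -
  have "((\<lambda>t. x + cvec (w * develop \<theta> t)) has_vector_derivative 0 + cvec (w * cis (\<theta> t))) (at t within {0..s})"
    by (intro has_vector_derivative_add has_vector_derivative_const
        bounded_linear.has_vector_derivative[OF bounded_linear_cvec]
        has_vector_derivative_mult_right develop_has_vector_derivative[OF assms])
  then show ?thesis
    by (intro has_vector_derivative_transform[OF assms(3) snd_angle_curve]) simp_all
qed

lemma velocity_angle_curve:
  assumes "0 < \<kappa>" "0 < s" "\<kappa>-lipschitz_on {0..s} \<theta>" "t \<in> {0..s}"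
  shows "velocity (angle_curve x w \<theta> s) t = cvec (w * cis (\<theta> t))"
  unfolding velocity_def fst_angle_curve
  by (intro vector_derivative_within_closed_interval angle_curve_has_vector_derivative[OF assms(1,3,4)] assms)

text \<open>Since \<open>cis\<close> is 1-Lipschitz, the velocity inherits the Lipschitz constant
  \<open>\<kappa>\<close> of the angle, and this bounds the second derivative wherever it exists.
  The piecewise derivative of the angle supplies the second derivative on each closed piece.\<close>

lemma constrained_curve_angle_curve:
  assumes "0 < \<kappa>" "0 < s" "\<kappa>-lipschitz_on {0..s} \<theta>" "piecewise_C1_on 0 s \<theta>" "norm w = 1"
  shows "constrained_curve \<kappa> (angle_curve x w \<theta> s)"
proof -
  define c where "c = angle_curve x w \<theta> s"
  define V where "V t = cvec (w * cis (\<theta> t))" for t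
  have s: "fst c = s" by (simp add: c_def)
  have vel: "velocity c t = V t" if "t \<in> {0..s}" for t
    using velocity_angle_curve assms that by (simp add: c_def V_def)
  have der: "(snd c has_vector_derivative V t) (at t within {0..s})" if "t \<in> {0..s}" for t
    using angle_curve_has_vector_derivative assms that by (simp add: c_def V_def)
  have lip: "\<kappa>-lipschitz_on {0..s} V"
  proof (rule lipschitz_onI)
    fix u v assume uv: "u \<in> {0..s}" "v \<in> {0..s}"
    have "dist (V u) (V v) = norm (w * (cis (\<theta> u) - cis (\<theta> v)))"
      by (simp add: V_def dist_norm right_diff_distrib flip: cvec_diff)
    also have "\<dots> = dist (cis (\<theta> u)) (cis (\<theta> v))" using assms(5) by (simp add: norm_mult dist_norm)
    also have "\<dots> \<le> dist (\<theta> u) (\<theta> v)" using dist_cis_le by (simp add: dist_real_def)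
    also have "\<dots> \<le> \<kappa> * dist u v" using lipschitz_onD[OF assms(3) uv] .
    finally show "dist (V u) (V v) \<le> \<kappa> * dist u v" .
  qed (use assms in simp)
  have C1: "Ck_on 1 0 s (snd c)"
    using der lipschitz_on_continuous_on[OF lip] unfolding One_nat_def Ck_on.simps by blast
  have C2: "piecewise_C2_on 0 s (snd c)"
  proof -
    from assms(4) obtain n p where p: "p 0 = 0" "p n = s" "\<forall>i<n. p i < p (Suc i)"
      and D: "\<And>i. i < n \<Longrightarrow> \<exists>\<theta>'. (\<forall>t\<in>{p i..p (Suc i)}. (\<theta> has_vector_derivative \<theta>' t) (at t within {p i..p (Suc i)})) \<and>
         continuous_on {p i..p (Suc i)} \<theta>'"
      unfolding piecewise_C1_on_def by blast
    have "Ck_on 2 (p i) (p (Suc i)) (snd c)" if i: "i < n" for i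
    proof -
      define S where "S = {p i..p (Suc i)}"
      have S: "S \<subseteq> {0..s}" using partition_subset[OF p(3) i] p by (simp add: S_def)
      obtain \<theta>' where \<theta>': "\<forall>t\<in>S. (\<theta> has_vector_derivative \<theta>' t) (at t within S)" "continuous_on S \<theta>'"
        using D[OF i] unfolding S_def by blast
      have cont: "continuous_on S \<theta>"
        using continuous_on_subset[OF continuous_angle[OF assms(1,3)] S] .
      have "(snd c has_vector_derivative V t) (at t within S)" if "t \<in> S" for t
        using der[of t] that S has_vector_derivative_within_subset by blast
      moreover have "(V has_vector_derivative cvec (w * (\<theta>' t *\<^sub>R (\<i> * cis (\<theta> t))))) (at t within S)" if "t \<in> S" for t
      proof -
        have "((\<lambda>t. cis (\<theta> t)) has_vector_derivative \<theta>' t *\<^sub>R (\<i> * cis (\<theta> t))) (at t within S)"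
        proof -
          have "(cis has_vector_derivative \<i> * cis (\<theta> t)) (at (\<theta> t) within \<theta> ` S)"
            using has_derivative_cis[of "\<lambda>x. x" "\<lambda>x. x" "\<theta> t" "\<theta> ` S"]
            by (simp add: has_vector_derivative_def)
          then show ?thesis
            using vector_diff_chain_within[of \<theta> "\<theta>' t" t S cis] \<theta>'(1) that by (simp add: o_def)
        qed
        then show ?thesis unfolding V_def[abs_def]
          by (intro bounded_linear.has_vector_derivative[OF bounded_linear_cvec] has_vector_derivative_mult_right)
      qed
      moreover have "continuous_on S (\<lambda>t. cvec (w * (\<theta>' t *\<^sub>R (\<i> * cis (\<theta> t)))))"
        by (intro bounded_linear.continuous_on[OF bounded_linear_cvec] continuous_intros cont \<theta>')
      ultimately show ?thesis unfolding numeral_2_eq_2 Ck_on.simps S_def[symmetric]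
        by (intro exI[of _ V] exI[of _ "\<lambda>t. cvec (w * (\<theta>' t *\<^sub>R (\<i> * cis (\<theta> t))))"] conjI ballI)
    qed
    then show ?thesis using p unfolding piecewise_C2_on_def by blast
  qed
  have "norm a \<le> \<kappa>" if "t \<in> {0..s}" "(velocity c has_vector_derivative a) (at t within {0..s})" for t a
  proof (rule norm_vector_derivative_le_lipschitz[OF lip that(1)])
    show "(V has_vector_derivative a) (at t within {0..s})"
      using has_vector_derivative_transform[OF that(1) _ that(2)] vel by simp
    show "at t within {0..s} \<noteq> bot" using that(1) assms(2)
      by (metis atLeastAtMost_iff at_within_Icc_at_left at_within_Icc_at_right at_within_Icc_at
          order_le_less trivial_limit_at trivial_limit_at_left_real trivial_limit_at_right_real)
  qed
  moreover have "norm (velocity c t) = 1" if "t \<in> {0..s}" for t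
    using vel[OF that] assms(5) by (simp add: V_def norm_mult)
  moreover have "snd c \<in> extensional {0..s}" by (simp add: c_def angle_curve_def)
  ultimately show ?thesis
    using C1 C2 assms(2) unfolding constrained_curve_def Let_def c_def[symmetric] s by blast
qed

text \<open>The velocity is a continuous nonvanishing function on an interval, hence has a
  continuous logarithm, whose imaginary part is the angle. The curvature bound controls its
  derivative inside the pieces, and continuity carries the Lipschitz bound across the subdivision
  points.\<close>

lemma angle_curve_exists:
  assumes "0 < \<kappa>" and c: "constrained_curve \<kappa> c"
  obtains \<theta> where "\<kappa>-lipschitz_on {0..fst c} \<theta>" "piecewise_C1_on 0 (fst c) \<theta>"
    "c = angle_curve (snd c 0) 1 \<theta> (fst c)"
proof -
  define s where "s = fst c"
  define V where "V = velocity c"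
  have cc: "0 < s" "snd c \<in> extensional {0..s}" "Ck_on 1 0 s (snd c)" "piecewise_C2_on 0 s (snd c)"
    "\<And>t. t \<in> {0..s} \<Longrightarrow> norm (V t) = 1"
    "\<And>t a. t \<in> {0..s} \<Longrightarrow> (V has_vector_derivative a) (at t within {0..s}) \<Longrightarrow> norm a \<le> \<kappa>"
    using c unfolding constrained_curve_def Let_def s_def V_def by blast+
  have V: "(snd c has_vector_derivative V t) (at t within {0..s})" if "t \<in> {0..s}" for t
    using velocity_works[OF c] that by (simp add: V_def s_def)
  have contV: "continuous_on {0..s} V"
  proof -
    obtain f' where f': "\<And>t. t \<in> {0..s} \<Longrightarrow> (snd c has_vector_derivative f' t) (at t within {0..s})"
      "continuous_on {0..s} f'" using cc(3) unfolding One_nat_def Ck_on.simps by blast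
    have "V t = f' t" if "t \<in> {0..s}" for t
      using vector_derivative_unique_within_closed_interval[of 0 s t] V[OF that] f'(1)[OF that] cc(1) that by simp
    then show ?thesis using f'(2) continuous_on_cong by metis
  qed
  have "continuous_on {0..s} (\<lambda>t. vcomplex (V t))"
    by (rule bounded_linear.continuous_on[OF bounded_linear_vcomplex contV])
  moreover have "vcomplex (V t) \<noteq> 0" if "t \<in> {0..s}" for t
    using cc(5)[OF that] norm_vcomplex[of "V t"] by (metis norm_zero zero_neq_one)
  moreover have "contractible {0..s}" by (simp add: convex_imp_contractible)
  ultimately obtain g where g: "continuous_on {0..s} g" "\<And>t. t \<in> {0..s} \<Longrightarrow> vcomplex (V t) = exp (g t)"
    using continuous_logarithm_on_contractible by metis
  define \<theta> where "\<theta> t = Im (g t)" for t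
  have cis: "cis (\<theta> t) = vcomplex (V t)" if "t \<in> {0..s}" for t
  proof -
    have "exp (Re (g t)) = 1" using cc(5)[OF that] g(2)[OF that] norm_exp_eq_Re[of "g t"] by (metis norm_vcomplex)
    then show ?thesis using g(2)[OF that] exp_eq_polar[of "g t"] by (simp add: \<theta>_def)
  qed
  have cont: "continuous_on {0..s} \<theta>" unfolding \<theta>_def by (intro continuous_intros g)
  obtain n p where p: "p 0 = 0" "p n = s" "\<forall>i<n. p i < p (Suc i)"
    and p2: "\<And>i. i < n \<Longrightarrow> Ck_on 2 (p i) (p (Suc i)) (snd c)"
    using cc(4) unfolding piecewise_C2_on_def by blast
  have piece: "\<exists>\<theta>'. (\<forall>t\<in>{p i..p (Suc i)}. (\<theta> has_vector_derivative \<theta>' t) (at t within {p i..p (Suc i)})) \<and>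
      continuous_on {p i..p (Suc i)} \<theta>' \<and> (\<forall>t\<in>{p i<..<p (Suc i)}. \<bar>\<theta>' t\<bar> \<le> \<kappa>)" if i: "i < n" for i
  proof -
    define S where "S = {p i..p (Suc i)}"
    have S: "S \<subseteq> {0..s}" using partition_subset[OF p(3) i] p by (simp add: S_def)
    have lt: "p i < p (Suc i)" using p(3) i by simp
    obtain f' f'' where f': "\<And>t. t \<in> S \<Longrightarrow> (snd c has_vector_derivative f' t) (at t within S)"
      and f'': "\<And>t. t \<in> S \<Longrightarrow> (f' has_vector_derivative f'' t) (at t within S)" "continuous_on S f''"
      using p2[OF i] unfolding numeral_2_eq_2 Ck_on.simps S_def by blast
    \<comment> \<open>The first derivative found on the piece agrees with the global velocity, also
      at the ends of the piece, because derivatives within a nondegenerate closed interval are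
      unique.\<close>
    have "V t = f' t" if "t \<in> S" for t
    proof -
      have "(snd c has_vector_derivative V t) (at t within S)"
        using V[of t] that S has_vector_derivative_within_subset by blast
      then show ?thesis
        using vector_derivative_unique_within_closed_interval[of "p i" "p (Suc i)" t] f'[OF that] lt that
        by (simp add: S_def)
    qed
    then have V': "(V has_vector_derivative f'' t) (at t within S)" if "t \<in> S" for t
      using has_vector_derivative_transform[OF that _ f''(1)[OF that]] by simp
    define \<theta>' where "\<theta>' t = Im (cis (- \<theta> t) * vcomplex (f'' t))" for t
    have contS: "continuous_on S \<theta>" using continuous_on_subset[OF cont S] .
    have "(\<theta> has_vector_derivative \<theta>' t) (at t within S)" if "t \<in> S" for t
      unfolding \<theta>'_def
    proof (rule angle_has_vector_derivative[OF contS that])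
      have "((\<lambda>u. vcomplex (V u)) has_vector_derivative vcomplex (f'' t)) (at t within S)"
        by (rule bounded_linear.has_vector_derivative[OF bounded_linear_vcomplex V'[OF that]])
      then show "((\<lambda>u. cis (\<theta> u)) has_vector_derivative vcomplex (f'' t)) (at t within S)"
        by (rule has_vector_derivative_transform[OF that, rotated]) (use cis S in auto)
    qed
    moreover have "continuous_on S \<theta>'"
      unfolding \<theta>'_def
      by (intro continuous_intros contS bounded_linear.continuous_on[OF bounded_linear_vcomplex] f'')
    \<comment> \<open>Only inside the piece is the derivative within it a derivative of the velocity
      on the whole interval, so only there does the curvature clause apply.\<close>
    moreover have "\<bar>\<theta>' t\<bar> \<le> \<kappa>" if "t \<in> {p i<..<p (Suc i)}" for t
    proof -
      have "t \<in> S" using that by (auto simp: S_def)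
      moreover have "at t within S = at t" using that by (simp add: S_def at_within_Icc_at)
      ultimately have "(V has_vector_derivative f'' t) (at t within {0..s})"
        using V'[of t] by (simp add: has_vector_derivative_at_within)
      then have "norm (f'' t) \<le> \<kappa>" using cc(6) \<open>t \<in> S\<close> S by blast
      moreover have "\<bar>\<theta>' t\<bar> \<le> norm (cis (- \<theta> t) * vcomplex (f'' t))"
        unfolding \<theta>'_def by (rule abs_Im_le_cmod)
      ultimately show ?thesis by (simp add: norm_mult)
    qed
    ultimately show ?thesis unfolding S_def by blast
  qed
  have "piecewise_C1_on 0 s \<theta>"
    unfolding piecewise_C1_on_def using p piece by (intro exI[of _ n] exI[of _ p]) blast
  moreover have lip: "\<kappa>-lipschitz_on {0..s} \<theta>"
  proof (rule lipschitz_on_derivative_bound[OF _ cont])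
    show "finite (p ` {..n})" by simp
    fix t assume t: "t \<in> {0<..<s} - p ` {..n}"
    then obtain i where i: "i < n" "p i < t" "t < p (Suc i)"
      using partition_cover[of t p n] p by auto
    then obtain \<theta>' where "(\<theta> has_vector_derivative \<theta>' t) (at t within {p i..p (Suc i)})" "\<bar>\<theta>' t\<bar> \<le> \<kappa>"
      using piece[OF i(1)] by fastforce
    then show "\<exists>D. (\<theta> has_vector_derivative D) (at t) \<and> \<bar>D\<bar> \<le> \<kappa>"
      using i by (auto simp: at_within_Icc_at)
  qed (use assms in simp)
  moreover have "c = angle_curve (snd c 0) 1 \<theta> s"
  proof -
    have "snd c t = snd c 0 + cvec (develop \<theta> t)" if t: "t \<in> {0..s}" for t
    proof -
      have "(V has_integral (snd c t - snd c 0)) {0..t}"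
      proof (rule fundamental_theorem_of_calculus)
        fix u assume "u \<in> {0..t}"
        then have "u \<in> {0..s}" using t by auto
        then show "(snd c has_vector_derivative V u) (at u within {0..t})"
          by (rule has_vector_derivative_within_subset[OF V]) (use t in auto)
      qed (use t in simp)
      then have "((\<lambda>u. vcomplex (V u)) has_integral vcomplex (snd c t - snd c 0)) {0..t}"
        by (rule has_integral_linear[OF _ bounded_linear_vcomplex, unfolded o_def])
      then have "((\<lambda>u. cis (\<theta> u)) has_integral vcomplex (snd c t - snd c 0)) {0..t}"
        by (rule has_integral_eq[rotated]) (use cis t in auto)
      then have "develop \<theta> t = vcomplex (snd c t - snd c 0)"
        unfolding develop_def by (rule integral_unique)
      then show ?thesis by simp
    qed
    then have snd_eq: "snd c = snd (angle_curve (snd c 0) 1 \<theta> s)"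
      unfolding angle_curve_def snd_conv mult_1
      by (intro extensionalityI[OF cc(2) restrict_extensional]) (simp only: restrict_apply if_True)
    show ?thesis by (rule prod_eqI[OF _ snd_eq]) (simp add: s_def)
  qed
  ultimately show ?thesis unfolding s_def by - (rule that)
qed


section \<open>Shrinking a short curve to the segment\<close>

text \<open>The rescaled velocity has constant norm equal to the length, so the derivative part of
  the metric already dominates the difference of lengths.\<close>

lemma abs_fst_diff_le_curve_dist:
  assumes "a \<in> curve_space \<kappa> x y" "b \<in> curve_space \<kappa> x y"
  shows "\<bar>fst a - fst b\<bar> \<le> curve_dist \<kappa> x y a b"
proof -
  have ab: "constrained_curve \<kappa> a" "constrained_curve \<kappa> b" using assms by (auto simp: curve_space_def)
  have "\<bar>fst a - fst b\<bar> \<le> dist (rescaled_velocity a 0) (rescaled_velocity b 0)"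
    using norm_rescaled_velocity[OF ab(1), of 0] norm_rescaled_velocity[OF ab(2), of 0]
      norm_triangle_ineq3[of "rescaled_velocity a 0" "rescaled_velocity b 0"] by (simp add: dist_norm)
  also have "\<dots> \<le> (SUP t\<in>{0..1}. dist (rescaled_velocity a t) (rescaled_velocity b t))"
    by (intro cSUP_upper bdd_above_dist bounded_rescaled_velocity[OF ab(1)] bounded_rescaled_velocity[OF ab(2)]) auto
  also have "\<dots> \<le> curve_dist \<kappa> x y a b"
    using assms SUP_dist_nonneg[OF bounded_rescaled[OF ab(1)] bounded_rescaled[OF ab(2)]]
    by (simp add: curve_dist_def C1_dist_def)
  finally show ?thesis .
qed

lemma continuous_map_curve_length: "continuous_map (curve_topology \<kappa> x y) euclideanreal fst"
  unfolding curve_topology_def Metric_space.continuous_map_from_metric[OF Metric_space_curve_space]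
proof (intro conjI ballI allI impI)
  fix a U assume a: "a \<in> curve_space \<kappa> x y" "openin euclideanreal U \<and> fst a \<in> U"
  then obtain e where e: "e > 0" "ball (fst a) e \<subseteq> U" by (auto simp: open_contains_ball)
  have "fst b \<in> U" if "b \<in> curve_space \<kappa> x y" "curve_dist \<kappa> x y a b < e" for b
    using abs_fst_diff_le_curve_dist[OF a(1) that(1)] that(2) e(2)
    by (intro subsetD[OF e(2)]) (simp add: dist_real_def)
  then show "\<exists>r>0. \<forall>b. b \<in> curve_space \<kappa> x y \<and> curve_dist \<kappa> x y a b < r \<longrightarrow> fst b \<in> U"
    using e(1) by blast
qed simp

text \<open>Joint continuity on the compact unit square is uniform, which turns pointwise dependence
  on the homotopy parameter into dependence in the \<open>C1_dist\<close> sense.\<close>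

lemma continuous_map_curve_topology:
  assumes H: "\<And>\<mu>. \<mu> \<in> {0..1} \<Longrightarrow> H \<mu> \<in> curve_space \<kappa> x y"
    and F: "continuous_on ({0..1} \<times> {0..1}) F" and V: "continuous_on ({0..1} \<times> {0..1}) V"
    and HF: "\<And>\<mu> u. \<mu> \<in> {0..1} \<Longrightarrow> u \<in> {0..1} \<Longrightarrow> rescaled (H \<mu>) u = F (\<mu>, u)"
    and HV: "\<And>\<mu> u. \<mu> \<in> {0..1} \<Longrightarrow> u \<in> {0..1} \<Longrightarrow> rescaled_velocity (H \<mu>) u = V (\<mu>, u)"
  shows "continuous_map (top_of_set {0..1::real}) (curve_topology \<kappa> x y) H"
  unfolding curve_topology_def Metric_space.continuous_map_to_metric[OF Metric_space_curve_space]
proof (intro ballI allI impI)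
  fix \<mu> and \<epsilon> :: real assume "\<mu> \<in> topspace (top_of_set {0..1::real})" and "0 < \<epsilon>"
  then have \<mu>: "\<mu> \<in> {0..1}" by simp
  have comp: "compact ({0..1::real} \<times> {0..1::real})" by (intro compact_Times compact_Icc)
  \<comment> \<open>With thirds each of the two suprema is at most \<open>\<epsilon> / 3\<close>, so
    their sum stays strictly below \<open>\<epsilon>\<close> although suprema preserve only weak
    inequalities.\<close>
  obtain d1 where d1: "d1 > 0" "\<And>p q. p \<in> {0..1} \<times> {0..1} \<Longrightarrow> q \<in> {0..1} \<times> {0..1} \<Longrightarrow> dist q p < d1 \<Longrightarrow> dist (F q) (F p) < \<epsilon> / 3"
    using compact_uniformly_continuous[OF F comp] \<open>0 < \<epsilon>\<close> unfolding uniformly_continuous_on_def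
    by (metis divide_pos_pos zero_less_numeral)
  obtain d2 where d2: "d2 > 0" "\<And>p q. p \<in> {0..1} \<times> {0..1} \<Longrightarrow> q \<in> {0..1} \<times> {0..1} \<Longrightarrow> dist q p < d2 \<Longrightarrow> dist (V q) (V p) < \<epsilon> / 3"
    using compact_uniformly_continuous[OF V comp] \<open>0 < \<epsilon>\<close> unfolding uniformly_continuous_on_def
    by (metis divide_pos_pos zero_less_numeral)
  define U where "U = {0..1} \<inter> ball \<mu> (min d1 d2)"
  have "openin (top_of_set {0..1}) U" unfolding U_def by (simp add: openin_open_Int)
  moreover have "\<mu> \<in> U" using \<mu> d1 d2 by (simp add: U_def)
  moreover have "H \<nu> \<in> Metric_space.mball (curve_space \<kappa> x y) (curve_dist \<kappa> x y) (H \<mu>) \<epsilon>" if "\<nu> \<in> U" for \<nu>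
  proof -
    have \<nu>: "\<nu> \<in> {0..1}" "dist \<mu> \<nu> < d1" "dist \<mu> \<nu> < d2" using that by (auto simp: U_def)
    have d: "dist (\<mu>, u) (\<nu>, u) = dist \<mu> \<nu>" for u :: real by (simp add: dist_Pair_Pair)
    have "(SUP u\<in>{0..1}. dist (rescaled (H \<mu>) u) (rescaled (H \<nu>) u)) \<le> \<epsilon> / 3"
      using d1(2)[of "(\<nu>, u)" "(\<mu>, u)" for u] \<mu> \<nu> d HF by (intro cSUP_least) (auto intro: less_imp_le)
    moreover have "(SUP u\<in>{0..1}. dist (rescaled_velocity (H \<mu>) u) (rescaled_velocity (H \<nu>) u)) \<le> \<epsilon> / 3"
      using d2(2)[of "(\<nu>, u)" "(\<mu>, u)" for u] \<mu> \<nu> d HV by (intro cSUP_least) (auto intro: less_imp_le)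
    ultimately have "curve_dist \<kappa> x y (H \<mu>) (H \<nu>) < \<epsilon>"
      using H \<mu> \<nu> \<open>0 < \<epsilon>\<close> by (simp add: curve_dist_def C1_dist_def)
    then show ?thesis using H \<mu> \<nu> by (simp add: Metric_space.in_mball[OF Metric_space_curve_space])
  qed
  ultimately show "\<exists>U. openin (top_of_set {0..1}) U \<and> \<mu> \<in> U \<and>
      (\<forall>\<nu>\<in>U. H \<nu> \<in> Metric_space.mball (curve_space \<kappa> x y) (curve_dist \<kappa> x y) (H \<mu>) \<epsilon>)" by blast
qed

text \<open>Written as a rotated curve of angle 0 so that it is literally the end
  \<open>\<mu> = 0\<close> of the homotopy.\<close>

definition segment_curve :: "real^2 \<Rightarrow> real^2 \<Rightarrow> curve" where
  "segment_curve x y = angle_curve x (vcomplex (y - x) / norm (y - x)) (\<lambda>_. 0) (norm (y - x))"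

lemma develop_zero: "0 \<le> t \<Longrightarrow> develop (\<lambda>_. 0) t = of_real t"
  by (simp add: develop_def scaleR_conv_of_real)

lemma develop_at_0 [simp]: "develop \<theta> 0 = 0"
  by (simp add: develop_def)

lemma segment_curve_in_curve_space:
  assumes "0 < \<kappa>" "x \<noteq> y"
  shows "segment_curve x y \<in> curve_space \<kappa> x y"
proof -
  have d: "0 < norm (y - x)" using assms by simp
  have "constrained_curve \<kappa> (segment_curve x y)"
    unfolding segment_curve_def
  proof (rule constrained_curve_angle_curve[OF assms(1) d])
    show "\<kappa>-lipschitz_on {0..norm (y - x)} (\<lambda>_. 0)" using assms by (intro lipschitz_onI) auto
    show "piecewise_C1_on 0 (norm (y - x)) (\<lambda>_. 0)"
      unfolding piecewise_C1_on_def
      by (intro exI[of _ 1] exI[of _ "\<lambda>i. real i * norm (y - x)"]) (use d in \<open>auto intro!: exI[of _ "\<lambda>_. 0"]\<close>)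
    show "norm (vcomplex (y - x) / norm (y - x)) = 1" using d by (simp add: norm_divide)
  qed
  then show ?thesis
    using d by (simp add: curve_space_def segment_curve_def snd_angle_curve develop_zero
        linear_0[OF bounded_linear.linear[OF bounded_linear_cvec]])
qed

text \<open>The angle function relative to the chord is scaled down by \<open>\<mu>\<close>, which lengthens the chord; the
  curve is then cut off at the parameter \<open>cut \<mu>\<close> where its chord has the original length, and rotated
  back by \<open>w \<mu>\<close>.\<close>

lemma path_component_of_segment_curve:
  assumes "0 < \<kappa>" "x \<noteq> y" and c: "c \<in> curve_space \<kappa> x y" and short: "\<kappa> * fst c < pi"
  shows "path_component_of (curve_topology \<kappa> x y) (segment_curve x y) c"
proof -
  define s where "s = fst c"
  have cc: "constrained_curve \<kappa> c" "snd c 0 = x" "snd c s = y" using c by (auto simp: curve_space_def s_def)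
  have s: "0 < s" "\<kappa> * s < pi" using cc(1) short by (auto simp: constrained_curve_def Let_def s_def)
  obtain \<theta> where \<theta>: "\<kappa>-lipschitz_on {0..s} \<theta>" "piecewise_C1_on 0 s \<theta>" and c_eq: "c = angle_curve x 1 \<theta> s"
    using angle_curve_exists[OF assms(1) cc(1)] cc(2) unfolding s_def by metis
  define Y where "Y = vcomplex (y - x)"
  define d where "d = norm (y - x)"
  have d: "0 < d" "norm Y = d" using assms by (simp_all add: d_def Y_def)
  have Y: "Y = develop \<theta> s"
    using cc(3) s snd_angle_curve[of s s x 1 \<theta>] by (simp add: Y_def c_eq flip: vcomplex_diff)
      (metis add_diff_cancel_left' vcomplex_cvec)
  \<comment> \<open>\<open>\<phi>\<close> is the branch of the chord's direction closest to the
    tangent angle at the midpoint. By Schur's comparison they differ by less than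
    \<open>pi / 2\<close>, and the tangent angle varies by less than \<open>pi / 2\<close> on either
    side of the midpoint.\<close>
  obtain \<phi> where \<phi>: "Y = d * cis \<phi>" "\<And>t. t \<in> {0..s} \<Longrightarrow> \<bar>\<theta> t - \<phi>\<bar> \<le> pi"
  proof -
    define m where "m = s / 2"
    define z where "z = cis (- \<theta> m) * Y"
    have "\<kappa> * m < pi / 2" using s by (simp add: m_def)
    moreover have "0 < \<kappa> * m" using s assms by (simp add: m_def)
    ultimately have "0 < sin (\<kappa> * m)" by (intro sin_gt_zero) auto
    moreover have "s - m = m" by (simp add: m_def)
    ultimately have "0 < (sin (\<kappa> * (s - m)) + sin (\<kappa> * (m - 0))) / \<kappa>"
      using assms by simp
    also have "\<dots> \<le> Re (cis (- \<theta> m) * (develop \<theta> s - develop \<theta> 0))"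
    proof (rule Schur_comparison[OF assms(1) \<theta>(1)])
      show "0 \<le> m" "m \<le> s" using s by (simp_all add: m_def)
      have "\<kappa> * m \<le> pi" using \<open>\<kappa> * m < pi / 2\<close> pi_gt_zero by linarith
      then show "\<kappa> * (s - m) \<le> pi" "\<kappa> * (m - 0) \<le> pi" using \<open>s - m = m\<close> by simp_all
    qed simp_all
    finally have "0 < Re z" by (simp add: z_def Y)
    then have beta: "\<bar>Im (Ln z)\<bar> < pi / 2" "z \<noteq> 0" using Re_Ln_pos_lt_imp by auto
    have "norm z = d" using d by (simp add: z_def norm_mult)
    then have "z = d * cis (Im (Ln z))"
      using exp_eq_polar[of "Ln z"] beta norm_exp_eq_Re[of "Ln z"] by (simp flip: of_real_exp)
    then have "cis (\<theta> m) * z = d * cis (\<theta> m + Im (Ln z))"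
      by (metis cis_mult mult.left_commute)
    moreover have "cis (\<theta> m) * z = Y" by (simp add: z_def cis_mult flip: mult.assoc)
    ultimately have "Y = d * cis (\<theta> m + Im (Ln z))" by simp
    moreover have "\<bar>\<theta> t - (\<theta> m + Im (Ln z))\<bar> \<le> pi" if "t \<in> {0..s}" for t
    proof -
      have "\<bar>\<theta> t - \<theta> m\<bar> \<le> \<kappa> * \<bar>t - m\<bar>"
        using lipschitz_onD[OF \<theta>(1), of t m] that s by (simp add: dist_real_def m_def)
      also have "\<dots> \<le> \<kappa> * m" using that assms(1) by (intro mult_left_mono) (auto simp: m_def abs_if)
      finally show ?thesis using beta \<open>\<kappa> * m < pi / 2\<close> by linarith
    qed
    ultimately show ?thesis using that by blast
  qed
  define A where "A \<mu> t = \<mu> * (\<theta> t - \<phi>)" for \<mu> t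
  define Z where "Z \<mu> t = develop (A \<mu>) t" for \<mu> t
  have lipA: "\<kappa>-lipschitz_on {0..s} (A \<mu>)" if "\<mu> \<in> {0..1}" for \<mu>
  proof (rule lipschitz_onI)
    fix u v assume "u \<in> {0..s}" "v \<in> {0..s}"
    then have "\<bar>\<theta> u - \<theta> v\<bar> \<le> \<kappa> * dist u v" using lipschitz_onD[OF \<theta>(1)] by (auto simp: dist_real_def)
    moreover have "dist (A \<mu> u) (A \<mu> v) = \<mu> * \<bar>\<theta> u - \<theta> v\<bar>"
      using that by (simp add: A_def dist_real_def abs_mult flip: right_diff_distrib)
    moreover have "\<mu> * \<bar>\<theta> u - \<theta> v\<bar> \<le> \<bar>\<theta> u - \<theta> v\<bar>" using that by (simp add: mult_left_le_one_le)
    ultimately show "dist (A \<mu> u) (A \<mu> v) \<le> \<kappa> * dist u v" by linarith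
  qed (use assms in simp)
  have pwA: "piecewise_C1_on 0 s (A \<mu>)" for \<mu>
    using piecewise_C1_on_affine[OF \<theta>(2)] by (simp add: A_def[abs_def])
  have intA: "(\<lambda>v. cis (A \<mu> v)) integrable_on {0..t}" if "\<mu> \<in> {0..1}" "t \<le> s" for \<mu> t
    using cis_angle_integrable[OF assms(1) lipA] that by simp
  have Z1: "Z 1 t = cis (- \<phi>) * develop \<theta> t" for t
    unfolding Z_def develop_def by (simp add: A_def cis_mult flip: integral_mult_right)
  \<comment> \<open>As the relative angle stays within pi, scaling it by
    \<open>\<mu> \<le> 1\<close> raises its cosine, so progress in the chord direction does not drop
    below its value \<open>d\<close> at \<open>\<mu> = 1\<close>.\<close>
  have chord: "d \<le> norm (Z \<mu> s)" if \<mu>: "\<mu> \<in> {0..1}" for \<mu>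
  proof -
    have Re_int: "((\<lambda>v. cos (A \<nu> v)) has_integral Re (Z \<nu> s)) {0..s}" if "\<nu> \<in> {0..1}" for \<nu>
      using has_integral_linear[OF integrable_integral[OF intA[OF that order_refl]] bounded_linear_Re]
      by (simp add: o_def Z_def develop_def)
    have "Re (Z 1 s) \<le> Re (Z \<mu> s)"
    proof (rule has_integral_le[OF Re_int Re_int[OF \<mu>]])
      fix t assume "t \<in> {0..s}"
      then have "\<bar>\<theta> t - \<phi>\<bar> \<le> pi" by (rule \<phi>)
      moreover have "\<bar>A \<mu> t\<bar> \<le> \<bar>\<theta> t - \<phi>\<bar>" using \<mu> by (simp add: A_def abs_mult mult_left_le_one_le)
      ultimately have "cos \<bar>\<theta> t - \<phi>\<bar> \<le> cos \<bar>A \<mu> t\<bar>" by (intro cos_monotone_0_pi_le) auto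
      then show "cos (A 1 t) \<le> cos (A \<mu> t)" by (simp add: A_def)
    qed simp
    moreover have "Z 1 s = d"
      by (simp add: Z1 \<phi>(1) cis_mult mult.left_commute flip: Y)
    ultimately show ?thesis using complex_Re_le_cmod[of "Z \<mu> s"] by simp
  qed
  have strict: "norm (Z \<mu> a) < norm (Z \<mu> b)" if "\<mu> \<in> {0..1}" "0 \<le> a" "a < b" "b \<le> s" for \<mu> a b
    unfolding Z_def using norm_develop_strict_mono[OF assms(1) lipA] s that by blast
  have uniq: "a = b" if "\<mu> \<in> {0..1}" "a \<in> {0..s}" "b \<in> {0..s}" "norm (Z \<mu> a) = norm (Z \<mu> b)" for \<mu> a b
    using strict[OF that(1), of a b] strict[OF that(1), of b a] that by (cases a b rule: linorder_cases) auto
  have "\<exists>t\<in>{0..s}. norm (Z \<mu> t) = d" if \<mu>: "\<mu> \<in> {0..1}" for \<mu>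
  proof -
    have "continuous_on {0..s} (\<lambda>t. norm (Z \<mu> t))"
      unfolding Z_def by (intro continuous_intros continuous_develop[OF assms(1) lipA[OF \<mu>]])
    then have "\<exists>t\<ge>0. t \<le> s \<and> norm (Z \<mu> t) = d"
      using chord[OF \<mu>] d s by (intro IVT') (auto simp: Z_def)
    then show ?thesis by auto
  qed
  then obtain cut where cut: "\<And>\<mu>. \<mu> \<in> {0..1} \<Longrightarrow> cut \<mu> \<in> {0..s}" "\<And>\<mu>. \<mu> \<in> {0..1} \<Longrightarrow> norm (Z \<mu> (cut \<mu>)) = d"
    by metis
  have cut_pos: "0 < cut \<mu>" if "\<mu> \<in> {0..1}" for \<mu>
  proof -
    have "cut \<mu> \<noteq> 0" using cut(2)[OF that] d by (auto simp: Z_def)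
    then show ?thesis using cut(1)[OF that] by auto
  qed
  \<comment> \<open>The constant 1 is the speed in \<open>t\<close>. The term \<open>pi * s\<close>
    arises because changing \<open>\<mu>\<close> to \<open>\<nu>\<close> changes every angle by at
    most \<open>pi * dist \<mu> \<nu>\<close>, over a length of at most \<open>s\<close>.\<close>
  have contZ: "continuous_on ({0..1} \<times> {0..s}) (\<lambda>p. Z (fst p) (snd p))"
  proof (rule lipschitz_on_continuous_on[of "1 + pi * s"], rule lipschitz_onI)
    fix p q :: "real \<times> real" assume "p \<in> {0..1} \<times> {0..s}" "q \<in> {0..1} \<times> {0..s}"
    then obtain \<mu> t \<nu> u where pq: "p = (\<mu>, t)" "q = (\<nu>, u)" "\<mu> \<in> {0..1}" "\<nu> \<in> {0..1}" "t \<in> {0..s}" "u \<in> {0..s}"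
      by auto
    have "dist (Z \<mu> t) (Z \<mu> u) \<le> dist t u"
      using norm_develop_diff_le[OF assms(1) lipA[OF pq(3)], of t u]
        norm_develop_diff_le[OF assms(1) lipA[OF pq(3)], of u t] pq
      by (cases "t \<le> u") (auto simp: dist_norm Z_def norm_minus_commute)
    moreover have "dist (Z \<mu> u) (Z \<nu> u) \<le> pi * s * dist \<mu> \<nu>"
    proof -
      have "norm (integral {0..u} (\<lambda>v. cis (A \<mu> v) - cis (A \<nu> v))) \<le> (pi * dist \<mu> \<nu>) * (u - 0)"
      proof (rule integral_bound)
        show "continuous_on {0..u} (\<lambda>v. cis (A \<mu> v) - cis (A \<nu> v))"
          by (rule continuous_on_subset[of "{0..s}"])
            (use pq in \<open>auto intro!: continuous_intros continuous_cis_angle[OF assms(1) lipA]\<close>)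
        fix v assume "v \<in> {0..u}"
        then have "\<bar>\<theta> v - \<phi>\<bar> \<le> pi" using \<phi>(2)[of v] pq by auto
        then have "dist \<mu> \<nu> * \<bar>\<theta> v - \<phi>\<bar> \<le> dist \<mu> \<nu> * pi" by (intro mult_left_mono) auto
        moreover have "\<bar>A \<mu> v - A \<nu> v\<bar> = dist \<mu> \<nu> * \<bar>\<theta> v - \<phi>\<bar>"
          by (simp add: A_def dist_real_def abs_mult flip: left_diff_distrib)
        ultimately show "norm (cis (A \<mu> v) - cis (A \<nu> v)) \<le> pi * dist \<mu> \<nu>"
          using dist_cis_le[of "A \<mu> v" "A \<nu> v"] by (simp add: dist_norm mult.commute)
      qed (use pq in simp)
      also have "\<dots> \<le> (pi * dist \<mu> \<nu>) * s" using pq by (intro mult_left_mono) auto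
      finally show ?thesis
        using integral_diff[OF intA[OF pq(3)] intA[OF pq(4)], of u] pq
        by (simp add: dist_norm Z_def develop_def mult_ac)
    qed
    ultimately have "dist (Z \<mu> t) (Z \<nu> u) \<le> dist t u + pi * s * dist \<mu> \<nu>"
      using dist_triangle[of "Z \<mu> t" "Z \<nu> u" "Z \<mu> u"] by linarith
    also have "\<dots> \<le> dist p q + pi * s * dist p q"
      using dist_fst_le[of p q] dist_snd_le[of p q] pq s by (intro add_mono mult_left_mono) auto
    finally show "dist (Z (fst p) (snd p)) (Z (fst q) (snd q)) \<le> (1 + pi * s) * dist p q"
      using pq by (simp add: algebra_simps)
  qed (use s in simp)
  \<comment> \<open>By uniqueness the graph of \<open>cut\<close> is a full level set of the
    continuous chord length, hence closed; a map into a compact interval with closed graph is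
    continuous.\<close>
  have cont_cut: "continuous_on {0..1} cut"
  proof (rule continuous_from_closed_graph[of "{0..s}"])
    have "(\<lambda>\<mu>. (\<mu>, cut \<mu>)) ` {0..1} = ({0..1} \<times> {0..s}) \<inter> (\<lambda>p. norm (Z (fst p) (snd p))) -` {d}"
    proof (intro equalityI subsetI)
      fix p assume "p \<in> ({0..1} \<times> {0..s}) \<inter> (\<lambda>p. norm (Z (fst p) (snd p))) -` {d}"
      then have p: "fst p \<in> {0..1}" "snd p \<in> {0..s}" "norm (Z (fst p) (snd p)) = d" by auto
      then have "snd p = cut (fst p)" using uniq cut by metis
      then show "p \<in> (\<lambda>\<mu>. (\<mu>, cut \<mu>)) ` {0..1}" using p(1) by (intro image_eqI[of _ _ "fst p"]) (simp_all add: prod_eq_iff)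
    qed (use cut in auto)
    also have "closed \<dots>"
      by (intro continuous_closed_preimage continuous_on_norm contZ closed_Times) auto
    finally show "closed ((\<lambda>\<mu>. (\<mu>, cut \<mu>)) ` {0..1})" .
  qed (use cut in auto)
  \<comment> \<open>The two complex numbers have the same modulus \<open>d\<close>, so the quotient
    is the rotation taking the cut-off end point to \<open>y - x\<close>.\<close>
  define w where "w \<mu> = Y / Z \<mu> (cut \<mu>)" for \<mu>
  have w1: "norm (w \<mu>) = 1" if "\<mu> \<in> {0..1}" for \<mu>
    using cut(2)[OF that] d by (simp add: w_def norm_divide)
  have cont_w: "continuous_on {0..1} w"
  proof -
    have "continuous_on {0..1} (\<lambda>\<mu>. Z (fst (\<mu>, cut \<mu>)) (snd (\<mu>, cut \<mu>)))"
      by (rule continuous_on_compose2[OF contZ]) (use cut in \<open>auto intro!: continuous_intros cont_cut\<close>)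
    moreover have "Z \<mu> (cut \<mu>) \<noteq> 0" if "\<mu> \<in> {0..1}" for \<mu> using cut(2)[OF that] d by auto
    ultimately show ?thesis unfolding w_def by (auto intro!: continuous_intros)
  qed
  define H where "H \<mu> = angle_curve x (w \<mu>) (A \<mu>) (cut \<mu>)" for \<mu>
  have lipH: "\<kappa>-lipschitz_on {0..cut \<mu>} (A \<mu>)" if "\<mu> \<in> {0..1}" for \<mu>
    using lipschitz_on_subset[OF lipA[OF that]] cut(1)[OF that] by auto
  have HC: "constrained_curve \<kappa> (H \<mu>)" if "\<mu> \<in> {0..1}" for \<mu>
    unfolding H_def
    using cut_pos[OF that] cut(1)[OF that]
    by (intro constrained_curve_angle_curve assms lipH that w1 piecewise_C1_on_truncate[OF pwA]) auto
  have "continuous_map (top_of_set {0..1::real}) (curve_topology \<kappa> x y) H"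
  proof (rule continuous_map_curve_topology[where
        F = "\<lambda>p. x + cvec (w (fst p) * Z (fst p) (cut (fst p) * snd p))" and
        V = "\<lambda>p. cut (fst p) *\<^sub>R cvec (w (fst p) * cis (A (fst p) (cut (fst p) * snd p)))"])
    show "H \<mu> \<in> curve_space \<kappa> x y" if "\<mu> \<in> {0..1}" for \<mu>
    proof -
      have "Z \<mu> (cut \<mu>) \<noteq> 0" using cut(2)[OF that] d by auto
      then have "w \<mu> * develop (A \<mu>) (cut \<mu>) = Y" by (simp add: w_def Z_def)
      then show ?thesis
        using HC[OF that] cut_pos[OF that]
        by (simp add: curve_space_def H_def snd_angle_curve Y_def
            linear_0[OF bounded_linear.linear[OF bounded_linear_cvec]])
    qed
    have c1: "continuous_on ({0..1} \<times> {0..1}) (\<lambda>p. g (fst p))" if "continuous_on {0..1} g"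
      for g :: "real \<Rightarrow> 'a :: topological_space"
      by (rule continuous_on_compose2[OF that]) (auto intro!: continuous_intros)
    have in_s: "cut \<mu> * u \<in> {0..cut \<mu>}" if "\<mu> \<in> {0..1}" "u \<in> {0..1}" for \<mu> u
      using cut(1)[OF that(1)] that(2) by (auto intro: mult_left_le)
    have in_s': "cut \<mu> * u \<in> {0..s}" if "\<mu> \<in> {0..1}" "u \<in> {0..1}" for \<mu> u
      using in_s[OF that] cut(1)[OF that(1)] by auto
    have c2: "continuous_on ({0..1} \<times> {0..1}) (\<lambda>p. cut (fst p) * snd p)"
      by (intro continuous_intros c1 cont_cut)
    have "continuous_on ({0..1} \<times> {0..1}) (\<lambda>p. Z (fst (fst p, cut (fst p) * snd p)) (snd (fst p, cut (fst p) * snd p)))"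
      by (rule continuous_on_compose2[OF contZ]) (use in_s' in \<open>auto intro!: continuous_intros c2 simp del: atLeastAtMost_iff\<close>)
    then show "continuous_on ({0..1} \<times> {0..1}) (\<lambda>p. x + cvec (w (fst p) * Z (fst p) (cut (fst p) * snd p)))"
      by (intro continuous_intros bounded_linear.continuous_on[OF bounded_linear_cvec] c1 cont_w) simp
    have "continuous_on ({0..1} \<times> {0..1}) (\<lambda>p. \<theta> (cut (fst p) * snd p))"
      by (rule continuous_on_compose2[OF continuous_angle[OF assms(1) \<theta>(1)] c2])
        (use in_s' in \<open>auto simp del: atLeastAtMost_iff\<close>)
    then show "continuous_on ({0..1} \<times> {0..1}) (\<lambda>p. cut (fst p) *\<^sub>R cvec (w (fst p) * cis (A (fst p) (cut (fst p) * snd p))))"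
      unfolding A_def
      by (intro continuous_intros bounded_linear.continuous_on[OF bounded_linear_cvec] c1 cont_w cont_cut)
    fix \<mu> u :: real assume \<mu>u: "\<mu> \<in> {0..1}" "u \<in> {0..1}"
    show "rescaled (H \<mu>) u = x + cvec (w (fst (\<mu>, u)) * Z (fst (\<mu>, u)) (cut (fst (\<mu>, u)) * snd (\<mu>, u)))"
      using snd_angle_curve[OF in_s[OF \<mu>u]] by (simp add: rescaled_def H_def Z_def)
    show "rescaled_velocity (H \<mu>) u = cut (fst (\<mu>, u)) *\<^sub>R cvec (w (fst (\<mu>, u)) * cis (A (fst (\<mu>, u)) (cut (fst (\<mu>, u)) * snd (\<mu>, u))))"
      using velocity_angle_curve[OF assms(1) cut_pos[OF \<mu>u(1)] lipH[OF \<mu>u(1)] in_s[OF \<mu>u]]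
      by (simp add: rescaled_velocity_eq[OF HC[OF \<mu>u(1)] \<mu>u(2)]) (simp add: H_def)
  qed
  moreover have "H 0 = segment_curve x y"
  proof -
    have A0: "A 0 = (\<lambda>_. 0)" by (simp add: A_def fun_eq_iff)
    have "cut 0 = d" using cut[of 0] by (simp add: Z_def A0 develop_zero)
    moreover have "w 0 = Y / d" using cut(1)[of 0] \<open>cut 0 = d\<close> d by (simp add: w_def Z_def A0 develop_zero)
    ultimately show ?thesis by (simp add: H_def segment_curve_def A0 Y_def d_def)
  qed
  moreover have "H 1 = c"
  proof -
    \<comment> \<open>At \<open>\<mu> = 1\<close> nothing is cut off, and \<open>w 1\<close> undoes
      the rotation by \<open>- \<phi>\<close> hidden in \<open>A 1\<close>.\<close>
    have "norm (Z 1 s) = d" using d by (simp add: Z1 norm_mult flip: Y)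
    then have l1: "cut 1 = s" using uniq[of 1 "cut 1" s] cut[of 1] s by simp
    have "w 1 * Z 1 t = develop \<theta> t" for t
      using d by (simp add: w_def l1 Z1 field_simps flip: Y) auto
    then show ?thesis by (simp add: H_def l1 c_eq angle_curve_def flip: Z_def)
  qed
  ultimately show ?thesis
    unfolding path_component_of_def pathin_def by blast
qed


section \<open>Short curves and the lens\<close>

text \<open>By the parallelogram law, points of a disk that are at least a diameter apart are
  antipodal.\<close>

lemma sum_eq_0_of_norm_diff_ge:
  fixes u v :: "'a :: real_inner"
  assumes "norm u \<le> r" "norm v \<le> r" "2 * r \<le> norm (u - v)"
  shows "u + v = 0"
proof -
  have "0 \<le> r" using assms(1) norm_ge_zero order_trans by blast
  then have "(norm u)\<^sup>2 \<le> r\<^sup>2" "(norm v)\<^sup>2 \<le> r\<^sup>2" "(2 * r)\<^sup>2 \<le> (norm (u - v))\<^sup>2"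
    using assms by (intro power_mono; simp)+
  moreover have "(norm (u + v))\<^sup>2 + (norm (u - v))\<^sup>2 = 2 * (norm u)\<^sup>2 + 2 * (norm v)\<^sup>2"
    by (simp add: power2_norm_eq_inner inner_simps inner_commute)
  moreover have "(2 * r)\<^sup>2 = 4 * r\<^sup>2" by (simp add: power_mult_distrib)
  ultimately have "(norm (u + v))\<^sup>2 \<le> 0" by linarith
  then show ?thesis by simp
qed

text \<open>With equal centres the whole circle would be \<open>{x, y}\<close>, so the antipode of
  \<open>x\<close> would be \<open>x\<close> or \<open>y\<close>; the former forces radius 0, the
  latter distance \<open>2 * r\<close>.\<close>

lemma sphere_Int_eq_pair_imp_centres_neq:
  fixes x y :: "'a :: real_inner"
  assumes "sphere a r \<inter> sphere b r = {x, y}" "0 < norm (x - y)" "norm (x - y) < 2 * r"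
  shows "a \<noteq> b"
proof
  assume "a = b"
  then have S: "sphere a r = {x, y}" using assms(1) by simp
  then have "norm (a - x) = r" by (auto simp: dist_norm set_eq_iff)
  then have "2 *\<^sub>R a - x \<in> sphere a r"
    by (simp add: dist_norm scaleR_2 algebra_simps norm_minus_commute)
  then consider "2 *\<^sub>R a - x = x" | "2 *\<^sub>R a - x = y" using S by auto
  then show False
  proof cases
    case 1
    then have "a = x" by (simp add: scaleR_2 algebra_simps) (metis add_right_imp_eq scaleR_2 scaleR_cancel_left zero_neq_numeral)
    then show False using \<open>norm (a - x) = r\<close> assms(2,3) by simp
  next
    case 2
    then have "x - y = 2 *\<^sub>R (x - a)" by (auto simp: scaleR_2 algebra_simps)
    then have "norm (x - y) = 2 * r" using \<open>norm (a - x) = r\<close> by (simp add: norm_minus_commute)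
    then show False using assms(3) by simp
  qed
qed

text \<open>By the parallelogram law the midpoint of the common chord is interior to both disks, and
  a closed convex set with nonempty interior is the closure of that interior.\<close>

lemma closure_interior_lens:
  fixes x y :: "'a :: euclidean_space"
  assumes "sphere a r \<inter> sphere b r = {x, y}" "0 < norm (x - y)"
  shows "closure (interior (cball a r \<inter> cball b r)) = cball a r \<inter> cball b r"
proof -
  have mid: "midpoint x y \<in> ball c r" if "x \<in> sphere c r" "y \<in> sphere c r" for c
  proof -
    have "norm ((x - c) + (y - c)) < 2 * r"
    proof (rule power2_less_imp_less)
      have "(norm ((x - c) + (y - c)))\<^sup>2 + (norm (x - y))\<^sup>2 = 2 * (norm (x - c))\<^sup>2 + 2 * (norm (y - c))\<^sup>2"
        by (simp add: power2_norm_eq_inner inner_simps inner_commute)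
      then show "(norm ((x - c) + (y - c)))\<^sup>2 < (2 * r)\<^sup>2"
        using that zero_less_power[OF assms(2), of 2]
        by (simp only: mem_sphere dist_norm norm_minus_commute[of c] power_mult_distrib power2_eq_square[of 2])
      show "0 \<le> 2 * r" using that by auto
    qed
    moreover have "(x - c) + (y - c) = 2 *\<^sub>R (midpoint x y - c)"
      by (simp add: midpoint_def scaleR_right_diff_distrib scaleR_2)
    ultimately show ?thesis by (simp add: dist_norm norm_minus_commute)
  qed
  have "midpoint x y \<in> interior (cball a r \<inter> cball b r)"
    using mid[of a] mid[of b] assms(1)[THEN equalityD2] by (simp add: interior_Int interior_cball)
  then show ?thesis
    by (subst convex_closure_interior) (auto simp: convex_Int closed_Int)
qed

section \<open>Curves shorter than a half circle of radius \<open>1 / \<kappa>\<close>\<close>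

context
  fixes \<kappa> :: real and x y :: "real^2"
  assumes kappa: "0 < \<kappa>"
begin

lemma chord_ge_of_curvature_bound:
  assumes "c \<in> curve_space \<kappa> x y" "t \<in> {0..fst c}" "\<kappa> * t \<le> 2 * pi"
  shows "2 * sin (\<kappa> * t / 2) / \<kappa> \<le> norm (snd c t - x)"
proof -
  obtain \<theta> where \<theta>: "\<kappa>-lipschitz_on {0..fst c} \<theta>" and c: "c = angle_curve x 1 \<theta> (fst c)"
    using angle_curve_exists[OF kappa, of c] assms(1) by (auto simp: curve_space_def)
  have "snd c t - x = cvec (develop \<theta> t)"
    by (subst c) (use assms(2) in \<open>simp add: snd_angle_curve\<close>)
  then show ?thesis
    using develop_chord_ge[OF kappa \<theta>, of 0 t] assms(2,3) by simp
qed

lemma length_neq_half_circle: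
  assumes "c \<in> curve_space \<kappa> x y" "norm (x - y) < 2 * (1 / \<kappa>)"
  shows "\<kappa> * fst c \<noteq> pi"
proof
  assume eq: "\<kappa> * fst c = pi"
  have c: "snd c (fst c) = y" "0 \<le> fst c"
    using assms(1) by (auto simp: curve_space_def constrained_curve_def Let_def)
  then have "2 / \<kappa> \<le> norm (y - x)"
    using chord_ge_of_curvature_bound[OF assms(1), of "fst c"] by (simp add: eq)
  then show False using assms(2) by (simp add: norm_minus_commute)
qed

text \<open>A longer curve would reach, at parameter \<open>pi / \<kappa>\<close>, a point a full
  diameter or more away from \<open>x\<close>. Both points lie in each disk, so each centre would be
  their midpoint, contrary to \<open>a \<noteq> b\<close>.\<close>

lemma length_less_half_circle:
  assumes c: "c \<in> curve_space \<kappa> x y" and "a \<noteq> b"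
    and region: "in_region c (cball a (1 / \<kappa>) \<inter> cball b (1 / \<kappa>))"
  shows "\<kappa> * fst c < pi"
proof (rule ccontr)
  assume "\<not> \<kappa> * fst c < pi"
  then have t: "pi / \<kappa> \<in> {0..fst c}" using kappa by (auto simp: field_simps)
  then have z: "0 \<in> {0..fst c}" by auto
  have x: "snd c 0 = x" using c by (simp add: curve_space_def)
  define q where "q = snd c (pi / \<kappa>)"
  have far: "2 * (1 / \<kappa>) \<le> norm (q - x)"
    using chord_ge_of_curvature_bound[OF c t] kappa by (simp add: q_def)
  have "(q - e) + (x - e) = 0" if "e = a \<or> e = b" for e
  proof (rule sum_eq_0_of_norm_diff_ge[of _ "1 / \<kappa>"])
    show "norm (q - e) \<le> 1 / \<kappa>" "norm (x - e) \<le> 1 / \<kappa>"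
      using bspec[OF region[unfolded in_region_def] t] bspec[OF region[unfolded in_region_def] z] that x
      by (auto simp: q_def dist_norm norm_minus_commute)
    show "2 * (1 / \<kappa>) \<le> norm (q - e - (x - e))" using far by simp
  qed
  then have "2 *\<^sub>R e = q + x" if "e = a \<or> e = b" for e
    using that[THEN \<open>\<And>e. e = a \<or> e = b \<Longrightarrow> (q - e) + (x - e) = 0\<close>] by (simp add: scaleR_2 algebra_simps)
  then have "2 *\<^sub>R a = q + x" "2 *\<^sub>R b = q + x" by blast+
  then have "2 *\<^sub>R a = 2 *\<^sub>R b" by simp
  then show False using assms(2) by simp
qed

lemma in_region_of_short:
  assumes c: "c \<in> curve_space \<kappa> x y" and short: "\<kappa> * fst c < pi"
    and "x \<in> sphere e (1 / \<kappa>)" "y \<in> sphere e (1 / \<kappa>)"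
  shows "in_region c (cball e (1 / \<kappa>))"
  unfolding in_region_def
proof
  fix t assume t: "t \<in> {0..fst c}"
  obtain \<theta> where \<theta>: "\<kappa>-lipschitz_on {0..fst c} \<theta>" and c_eq: "c = angle_curve x 1 \<theta> (fst c)"
    using angle_curve_exists[OF kappa, of c] c by (auto simp: curve_space_def)
  have q: "vcomplex (snd c u - e) = vcomplex (x - e) + 1 * develop \<theta> u" if "u \<in> {0..fst c}" for u
  proof -
    have "snd c u - e = (x - e) + cvec (develop \<theta> u)"
      by (subst c_eq) (use that in \<open>simp add: snd_angle_curve\<close>)
    then show ?thesis by (simp only: vcomplex_add vcomplex_cvec mult_1)
  qed
  have s: "fst c \<in> {0..fst c}" "snd c (fst c) = y" using t c by (auto simp: curve_space_def)
  have "norm (vcomplex (x - e) + 1 * develop \<theta> t) \<le> 1 / \<kappa>"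
  proof (rule develop_in_disc[OF kappa \<theta> _ _ _ _ t])
    show "norm (vcomplex (x - e) + 1 * develop \<theta> (fst c)) \<le> 1 / \<kappa>"
      using q[OF s(1)] assms(4) s by (simp add: dist_norm norm_minus_commute flip: q)
        (metis norm_vcomplex order_refl norm_minus_commute)
  qed (use short assms(3) in \<open>simp_all add: dist_norm norm_minus_commute\<close>)
  then show "snd c t \<in> cball e (1 / \<kappa>)"
    by (simp only: q[OF t, symmetric] norm_vcomplex) (simp add: dist_norm norm_minus_commute)
qed

text \<open>A continuous injection of a compact interval into a Hausdorff space is an
  embedding.\<close>

lemma embedded_of_short:
  assumes c: "c \<in> curve_space \<kappa> x y" and short: "\<kappa> * fst c < pi"
  shows "embedded c"
proof -
  obtain \<theta> where \<theta>: "\<kappa>-lipschitz_on {0..fst c} \<theta>" and c_eq: "c = angle_curve x 1 \<theta> (fst c)"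
    using angle_curve_exists[OF kappa, of c] c by (auto simp: curve_space_def)
  have eq: "snd c u = x + cvec (develop \<theta> u)" if "u \<in> {0..fst c}" for u
    by (subst c_eq) (use that in \<open>simp add: snd_angle_curve\<close>)
  have "continuous_on {0..fst c} (snd c)"
    unfolding continuous_on_eq_continuous_within
    using c velocity_works[of \<kappa> c, THEN has_vector_derivative_continuous]
    by (auto simp: curve_space_def)
  moreover have "inj_on (snd c) {0..fst c}"
  proof (rule inj_onI)
    fix u v assume uv: "u \<in> {0..fst c}" "v \<in> {0..fst c}" "snd c u = snd c v"
    then have "cvec (develop \<theta> u) = cvec (develop \<theta> v)" using eq[OF uv(1)] eq[OF uv(2)] by simp
    then have "develop \<theta> u = develop \<theta> v" by (metis vcomplex_cvec)
    then show "u = v" using inj_onD[OF inj_on_develop[OF kappa \<theta>]] short uv by simp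
  qed
  ultimately show ?thesis
    unfolding embedded_def by (intro continuous_imp_embedding_map) (auto simp: compact_space_subtopology)
qed

end

text \<open>Length is continuous along a path of curves, so by the intermediate value theorem it
  would have to pass through the forbidden value \<open>pi / \<kappa>\<close>.\<close>

lemma path_component_length_less:
  assumes "0 < \<kappa>" "norm (x - y) < 2 * (1 / \<kappa>)"
    and "path_component_of (curve_topology \<kappa> x y) c d" "\<kappa> * fst c < pi"
  shows "\<kappa> * fst d < pi"
proof (rule ccontr)
  assume d: "\<not> \<kappa> * fst d < pi"
  obtain g :: "real \<Rightarrow> curve" where g: "continuous_map (top_of_set {0..1}) (curve_topology \<kappa> x y) g" "g 0 = c" "g 1 = d"
    using assms(3) unfolding path_component_of_def pathin_def by blast
  have "continuous_on {0..1} (fst \<circ> g)"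
    using continuous_map_compose[OF g(1) continuous_map_curve_length] by simp
  then have "continuous_on {0..1} (\<lambda>t. \<kappa> * fst (g t))" by (intro continuous_on_mult_left) (simp add: o_def)
  then have "\<exists>t\<ge>0. t \<le> 1 \<and> \<kappa> * fst (g t) = pi"
    using assms(4) d g(2,3) by (intro IVT') auto
  then obtain t where t: "t \<in> {0..1}" "\<kappa> * fst (g t) = pi" by auto
  have "g t \<in> curve_space \<kappa> x y" using continuous_map_image_subset_topspace[OF g(1)] t(1) by auto
  then show False using length_neq_half_circle[OF assms(1) _ assms(2)] t(2) by blast
qed

theorem theorem4p21:
  fixes \<kappa> r :: real and x y c1 c2 :: "real^2" and D1 D2 region :: "(real^2) set"
  assumes "0 < \<kappa>" and "r = 1 / \<kappa>"
    and "0 < norm (x - y)" and "norm (x - y) < 2 * r"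
    and "D1 = cball c1 r" and "D2 = cball c2 r"
    and "sphere c1 r \<inter> sphere c2 r = {x, y}"
    and "region = interior (D1 \<inter> D2)"
  shows "{\<sigma> \<in> curve_space \<kappa> x y. in_region \<sigma> (closure region)} \<in> homotopy_classes \<kappa> x y \<and>
    (\<forall>\<sigma>\<in>{\<sigma> \<in> curve_space \<kappa> x y. in_region \<sigma> (closure region)}. embedded \<sigma>)"
proof -
  define S where "S = {\<sigma> \<in> curve_space \<kappa> x y. in_region \<sigma> (closure region)}"
  have region: "closure region = cball c1 (1 / \<kappa>) \<inter> cball c2 (1 / \<kappa>)"
    using closure_interior_lens[OF assms(7,3)] assms by simp
  have neq: "c1 \<noteq> c2" "x \<noteq> y"
    using sphere_Int_eq_pair_imp_centres_neq[OF assms(7,3,4)] assms(3) by auto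
  have xy: "x \<in> sphere c (1 / \<kappa>)" "y \<in> sphere c (1 / \<kappa>)" if "c = c1 \<or> c = c2" for c
    using assms(2,7) that by auto
  \<comment> \<open>Lying in the lens is replaced by a bound on the length, which a homotopy cannot
    cross.\<close>
  have S: "S = {\<sigma> \<in> curve_space \<kappa> x y. \<kappa> * fst \<sigma> < pi}"
    unfolding S_def region
  proof (intro Collect_cong conj_cong refl iffI)
    fix \<sigma> assume \<sigma>: "\<sigma> \<in> curve_space \<kappa> x y"
    show "\<kappa> * fst \<sigma> < pi" if "in_region \<sigma> (cball c1 (1 / \<kappa>) \<inter> cball c2 (1 / \<kappa>))"
      using length_less_half_circle[OF assms(1) \<sigma> neq(1) that] .
    show "in_region \<sigma> (cball c1 (1 / \<kappa>) \<inter> cball c2 (1 / \<kappa>))" if "\<kappa> * fst \<sigma> < pi"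
      using in_region_of_short[OF assms(1) \<sigma> that xy[of c1]] in_region_of_short[OF assms(1) \<sigma> that xy[of c2]]
      by (simp add: in_region_def)
  qed
  have short: "norm (x - y) < 2 * (1 / \<kappa>)" using assms by simp
  \<comment> \<open>The segment is itself short, as a diameter is shorter than a half circle; it
    serves as base point of the class.\<close>
  have "\<kappa> * norm (y - x) < 2" using short assms(1) by (simp add: field_simps norm_minus_commute)
  then have seg: "\<kappa> * fst (segment_curve x y) < pi"
    using pi_ge_two by (simp add: segment_curve_def)
  have "path_component_of_set (curve_topology \<kappa> x y) (segment_curve x y) = S"
  proof (intro equalityI subsetI)
    fix \<sigma> assume "\<sigma> \<in> S"
    then show "\<sigma> \<in> path_component_of_set (curve_topology \<kappa> x y) (segment_curve x y)"
      using path_component_of_segment_curve[OF assms(1) neq(2)] by (simp add: S)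
  next
    fix \<sigma> assume "\<sigma> \<in> path_component_of_set (curve_topology \<kappa> x y) (segment_curve x y)"
    then have \<sigma>: "path_component_of (curve_topology \<kappa> x y) (segment_curve x y) \<sigma>" by simp
    then show "\<sigma> \<in> S"
      using path_component_length_less[OF assms(1) short \<sigma> seg] path_component_in_topspace[OF \<sigma>]
      by (simp add: S)
  qed
  then have "S \<in> homotopy_classes \<kappa> x y"
    using segment_curve_in_curve_space[OF assms(1) neq(2)]
    by (auto simp: homotopy_classes_eq_path_components path_components_of_def)
  moreover have "\<forall>\<sigma>\<in>S. embedded \<sigma>"
    using embedded_of_short[OF assms(1)] by (auto simp: S)
  ultimately show ?thesis unfolding S_def by blast
qed

end
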